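(* Let $L\subseteq\Sigma^*$ be recognized by an $n$-state one-way probabilistic finite automaton with restart with error bound $\epsilon$. Then $L$ is recognized by a $(2n+4)$-state one-way quantum finite automaton with restart with the same error bound $\epsilon$. Moreover, if the expected runtime of the probabilistic automaton is $O(s(|w|))$, then the expected runtime of the quantum automaton is $O(l^{2|w|}s^2(|w|))$ for a constant $l>1$ depending on $n$, where $w$ is the input string.
   Context: Let $\vdash,\dashv\notin\Sigma$ be left and right end-markers and $\Gamma=\Sigma\cup\{\vdash,\dashv\}$. In both models below the state set $Q$ is partitioned into disjoint sets $Q_{non}$ (nonhalting), $Q_{acc}$ (accepting), $Q_{rej}$ (rejecting), $Q_{restart}$ (restarting), with an initial state $q_0\in Q_{non}$; on input $w$ the tape contains $\vdash w\dashv$, read from left to right one symbol per step starting, in each round, in $q_0$ on $\vdash$; entering (or measuring) an accepting/rejecting state halts with that answer, and entering (or measuring) a restarting state ends the round and starts a new round in $q_0$ with the head on $\vdash$; each round ends by halting or restarting with probability 1. A one-way probabilistic finite automaton with restart has for each $\sigma\in\Gamma$ a stochastic matrix giving the probabilities of moving from state $q$ to state $q'$ when reading $\sigma$. A one-way quantum finite automaton with restart has for each $\sigma\in\Gamma$ a unitary operator $U_\sigma$ on the Hilbert space with basis $\{|q\rangle: q\in Q\}$; on reading $\sigma$ it applies $U_\sigma$ to its state vector and then measures projectively onto the spans of $Q_{acc},Q_{rej},Q_{non},Q_{restart}$, continuing on outcome "nonhalting" with the normalized projection onto the span of $Q_{non}$. Overall acceptance/rejection probabilities are those of eventually accepting/rejecting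 over all rounds; the runtime counts all steps of all rounds. A machine recognizes $L$ with error bound $\epsilon$ if members of $L$ are accepted with probability at least $1-\epsilon$ and nonmembers are rejected with probability at least $1-\epsilon$. *)

theory Defs
  imports
    "HOL-Probability.Probability_Mass_Function"
    "HOL-Library.Landau_Symbols"
    "Jordan_Normal_Form.Schur_Decomposition"
begin

section \<open>Input tape\<close>

datatype 'a tape_symbol = Left_End | Letter 'a | Right_End

definition tape :: "'a list \<Rightarrow> 'a tape_symbol list" where
  "tape w = Left_End # map Letter w @ [Right_End]"


section \<open>Runs of one-way machines with restart\<close>

text \<open>
  The states of an \<open>n\<close>-state machine are \<open>0, \<dots>, n - 1\<close>; the partition of the state set into
  nonhalting, accepting, rejecting and restarting states is given by a function from states
  to kinds.
\<close>

datatype kind = Nonhalting | Accepting | Rejecting | Restarting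

text \<open>
  Both models are instances of one scheme. The local memory \<open>'c\<close> is a state of a probabilistic
  automaton, or the normalized state vector of a quantum automaton. Reading a symbol yields,
  at random, the kind of state that is entered (or measured) together with the new memory.
  In \<open>Running i c\<close> the head is about to read the tape square \<open>i\<close>.
\<close>

datatype 'c config = Running nat 'c | Accepted | Rejected

fun successor :: "'c \<Rightarrow> nat \<Rightarrow> kind \<times> 'c \<Rightarrow> 'c config" where
  "successor start i (Nonhalting, c) = Running (Suc i) c"
| "successor start i (Accepting, c) = Accepted"
| "successor start i (Rejecting, c) = Rejected"
| "successor start i (Restarting, c) = Running 0 start"

text \<open>
  The value for \<open>i \<ge> length (tape w)\<close> is irrelevant: \<open>rounds_end\<close> below excludes such
  configurations.
\<close>

fun config_step ::
  "'c \<Rightarrow> ('a tape_symbol \<Rightarrow> 'c \<Rightarrow> (kind \<times> 'c) pmf) \<Rightarrow> 'a list \<Rightarrow> 'c config \<Rightarrow> 'c config pmf" where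
  "config_step start \<delta> w (Running i c) =
     (if i < length (tape w) then map_pmf (successor start i) (\<delta> (tape w ! i) c)
      else return_pmf (Running i c))"
| "config_step start \<delta> w Accepted = return_pmf Accepted"
| "config_step start \<delta> w Rejected = return_pmf Rejected"

primrec run ::
  "'c \<Rightarrow> ('a tape_symbol \<Rightarrow> 'c \<Rightarrow> (kind \<times> 'c) pmf) \<Rightarrow> 'a list \<Rightarrow> nat \<Rightarrow> 'c config pmf" where
  "run start \<delta> w 0 = return_pmf (Running 0 start)"
| "run start \<delta> w (Suc t) = bind_pmf (run start \<delta> w t) (config_step start \<delta> w)"

text \<open>
  \<open>Accepted\<close> and \<open>Rejected\<close> are absorbing, so the limits exist and are the probabilities of
  eventually accepting and rejecting.
\<close>

definition acc_prob ::
  "'c \<Rightarrow> ('a tape_symbol \<Rightarrow> 'c \<Rightarrow> (kind \<times> 'c) pmf) \<Rightarrow> 'a list \<Rightarrow> real" where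
  "acc_prob start \<delta> w = lim (\<lambda>t. pmf (run start \<delta> w t) Accepted)"

definition rej_prob ::
  "'c \<Rightarrow> ('a tape_symbol \<Rightarrow> 'c \<Rightarrow> (kind \<times> 'c) pmf) \<Rightarrow> 'a list \<Rightarrow> real" where
  "rej_prob start \<delta> w = lim (\<lambda>t. pmf (run start \<delta> w t) Rejected)"

text \<open>
  With \<open>T\<close> the number of steps until the machine halts (\<open>\<infinity>\<close> if it never does), this is
  \<open>E T = (\<Sum>t. P (T > t))\<close>.
\<close>

definition expected_time ::
  "'c \<Rightarrow> ('a tape_symbol \<Rightarrow> 'c \<Rightarrow> (kind \<times> 'c) pmf) \<Rightarrow> 'a list \<Rightarrow> ennreal" where
  "expected_time start \<delta> w =
     (\<Sum>t. ennreal (measure_pmf.prob (run start \<delta> w t) {Running i c | i c. True}))"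

text \<open>
  With probability 1, every round has ended by the time the right end-marker has been read.
\<close>

definition rounds_end ::
  "'c \<Rightarrow> ('a tape_symbol \<Rightarrow> 'c \<Rightarrow> (kind \<times> 'c) pmf) \<Rightarrow> bool" where
  "rounds_end start \<delta> \<longleftrightarrow>
     (\<forall>w t i c. Running i c \<in> set_pmf (run start \<delta> w t) \<longrightarrow> i < length (tape w))"

definition recognizes ::
  "'c \<Rightarrow> ('a tape_symbol \<Rightarrow> 'c \<Rightarrow> (kind \<times> 'c) pmf) \<Rightarrow> 'a list set \<Rightarrow> real \<Rightarrow> bool" where
  "recognizes start \<delta> L \<epsilon> \<longleftrightarrow>
     (\<forall>w. (w \<in> L \<longrightarrow> acc_prob start \<delta> w \<ge> 1 - \<epsilon>) \<and>
          (w \<notin> L \<longrightarrow> rej_prob start \<delta> w \<ge> 1 - \<epsilon>))"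

text \<open>\<open>T w = O(f(|w|))\<close> as \<open>|w|\<close> tends to infinity, for a possibly infinite time \<open>T w\<close>.\<close>

definition time_bigo :: "('a list \<Rightarrow> ennreal) \<Rightarrow> (nat \<Rightarrow> real) \<Rightarrow> bool" where
  "time_bigo T f \<longleftrightarrow>
     (\<forall>\<^sub>F w in filtercomap length at_top. T w < \<infinity>) \<and>
     (\<lambda>w. enn2real (T w)) \<in> O[filtercomap length at_top](\<lambda>w. f (length w))"


section \<open>One-way probabilistic finite automata with restart\<close>

text \<open>
  \<open>pfa_trans P \<sigma> $$ (q', q)\<close> is the probability of moving from \<open>q\<close> to \<open>q'\<close> when reading \<open>\<sigma>\<close>,
  so the columns sum to 1.
\<close>

record 'a pfa =
  pfa_size :: nat
  pfa_kind :: "nat \<Rightarrow> kind"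
  pfa_init :: nat
  pfa_trans :: "'a tape_symbol \<Rightarrow> real mat"

definition stochastic :: "nat \<Rightarrow> real mat \<Rightarrow> bool" where
  "stochastic n A \<longleftrightarrow> A \<in> carrier_mat n n \<and>
     (\<forall>q<n. (\<forall>q'<n. A $$ (q', q) \<ge> 0) \<and> (\<Sum>q'<n. A $$ (q', q)) = 1)"

definition pfa_step :: "'a pfa \<Rightarrow> 'a tape_symbol \<Rightarrow> nat \<Rightarrow> (kind \<times> nat) pmf" where
  "pfa_step P \<sigma> q =
     map_pmf (\<lambda>q'. (pfa_kind P q', q'))
       (embed_pmf (\<lambda>q'. if q' < pfa_size P then pfa_trans P \<sigma> $$ (q', q) else 0))"

definition is_pfa_restart :: "'a pfa \<Rightarrow> bool" where
  "is_pfa_restart P \<longleftrightarrow>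
     pfa_init P < pfa_size P \<and> pfa_kind P (pfa_init P) = Nonhalting \<and>
     (\<forall>\<sigma>. stochastic (pfa_size P) (pfa_trans P \<sigma>)) \<and>
     rounds_end (pfa_init P) (pfa_step P)"

definition pfa_recognizes :: "'a pfa \<Rightarrow> 'a list set \<Rightarrow> real \<Rightarrow> bool" where
  "pfa_recognizes P = recognizes (pfa_init P) (pfa_step P)"

definition pfa_time :: "'a pfa \<Rightarrow> 'a list \<Rightarrow> ennreal" where
  "pfa_time P = expected_time (pfa_init P) (pfa_step P)"


section \<open>One-way quantum finite automata with restart\<close>

record 'a qfa =
  qfa_size :: nat
  qfa_kind :: "nat \<Rightarrow> kind"
  qfa_init :: nat
  qfa_op :: "'a tape_symbol \<Rightarrow> complex mat"

definition unitary :: "nat \<Rightarrow> complex mat \<Rightarrow> bool" where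
  "unitary n U \<longleftrightarrow> U \<in> carrier_mat n n \<and>
     mat_adjoint U * U = 1\<^sub>m n \<and> U * mat_adjoint U = 1\<^sub>m n"

definition norm_sq :: "complex vec \<Rightarrow> real" where
  "norm_sq v = (\<Sum>i<dim_vec v. (cmod (v $ i))\<^sup>2)"

definition normalize_vec :: "complex vec \<Rightarrow> complex vec" where
  "normalize_vec v = complex_of_real (1 / sqrt (norm_sq v)) \<cdot>\<^sub>v v"

text \<open>Orthogonal projection onto the span of the basis states of kind \<open>k\<close>.\<close>

definition kind_proj :: "'a qfa \<Rightarrow> kind \<Rightarrow> complex vec \<Rightarrow> complex vec" where
  "kind_proj M k v = vec (qfa_size M) (\<lambda>q. if qfa_kind M q = k then v $ q else 0)"

definition qfa_start :: "'a qfa \<Rightarrow> complex vec" where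
  "qfa_start M = unit_vec (qfa_size M) (qfa_init M)"

text \<open>
  Apply the operator, then measure the kind: outcome \<open>k\<close> has probability equal to the squared
  norm of the projection, and the state vector collapses to the normalized projection.
\<close>

definition qfa_step ::
  "'a qfa \<Rightarrow> 'a tape_symbol \<Rightarrow> complex vec \<Rightarrow> (kind \<times> complex vec) pmf" where
  "qfa_step M \<sigma> \<psi> =
     map_pmf (\<lambda>k. (k, normalize_vec (kind_proj M k (qfa_op M \<sigma> *\<^sub>v \<psi>))))
       (embed_pmf (\<lambda>k. norm_sq (kind_proj M k (qfa_op M \<sigma> *\<^sub>v \<psi>))))"

definition is_qfa_restart :: "'a qfa \<Rightarrow> bool" where
  "is_qfa_restart M \<longleftrightarrow>
     qfa_init M < qfa_size M \<and> qfa_kind M (qfa_init M) = Nonhalting \<and>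
     (\<forall>\<sigma>. unitary (qfa_size M) (qfa_op M \<sigma>)) \<and>
     rounds_end (qfa_start M) (qfa_step M)"

definition qfa_recognizes :: "'a qfa \<Rightarrow> 'a list set \<Rightarrow> real \<Rightarrow> bool" where
  "qfa_recognizes M = recognizes (qfa_start M) (qfa_step M)"

definition qfa_time :: "'a qfa \<Rightarrow> 'a list \<Rightarrow> ennreal" where
  "qfa_time M = expected_time (qfa_start M) (qfa_step M)"

end

theory Submission
  imports Defs
begin

text \<open>
  Because of the restarts, only the ratio of the acceptance probability \<open>a\<close> to the rejection
  probability \<open>b\<close> of a single round matters. The probabilistic automaton acts on one round by
  nonnegative matrices, to which two coordinates accumulating \<open>a\<close> and \<open>b\<close> are added. Divided by a
  constant \<open>c\<close> that depends only on \<open>n\<close>, each matrix becomes a small contraction, hence a block of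
  a unitary matrix whose remaining amplitude leaks into restarting states. On a tape of length \<open>N\<close>
  a round of the quantum automaton then accepts and rejects with amplitudes \<open>a / c ^ N\<close> and
  \<open>b / c ^ N\<close>; squaring the ratio can only decrease an error below \<open>1 / 2\<close>. The quantum automaton
  needs at most \<open>c ^ (2 * N) / (a\<^sup>2 + b\<^sup>2)\<close> rounds on average, the probabilistic one needs
  \<open>1 / (a + b)\<close> rounds and hence at least as many steps.

  The state count works out because an automaton with error below \<open>1 / 2\<close> has a halting state, which
  is never occupied within a round, so its coordinate can be reused as an accumulator. For an error
  bound of at least \<open>1 / 2\<close>, where squaring the ratio may increase the error, an automaton that
  accepts and rejects with equal probability suffices.
\<close>

section \<open>Unitary matrices with prescribed entries\<close>

text \<open>The \<open>k < N\<close> given vectors, padded with zero rows, form a singular square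
  matrix; a nonzero kernel vector, scaled to length 1, is the required \<open>z\<close>.\<close>

lemma exists_unit_orthogonal:
  fixes r :: "nat \<Rightarrow> nat \<Rightarrow> real"
  assumes "k < N"
  shows "\<exists>z. (\<Sum>i<N. z i * z i) = 1 \<and> (\<forall>j<k. (\<Sum>i<N. r j i * z i) = 0)"
proof -
  define A where "A = mat N N (\<lambda>(j, i). if j < k then r j i else 0)"
  have A: "A \<in> carrier_mat N N" by (simp add: A_def)
  have "A = mat\<^sub>r N N (\<lambda>j. if j = k then 0\<^sub>v N else row A j)"
    by (intro eq_matI) (auto simp: A_def)
  also have "det \<dots> = 0" using assms A by (intro det_row_0) auto
  finally have "det A = 0" .
  then obtain v where v: "v \<in> carrier_vec N" "v \<noteq> 0\<^sub>v N" "A *\<^sub>v v = 0\<^sub>v N"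
    using det_0_iff_vec_prod_zero_field[OF A] by auto
  define S where "S = (\<Sum>i<N. (v $ i)\<^sup>2)"
  have "\<exists>i<N. v $ i \<noteq> 0" using v(1,2) by (metis carrier_vecD eq_vecI index_zero_vec)
  then have "S > 0" unfolding S_def by (auto intro!: sum_pos2)
  define z where "z i = v $ i / sqrt S" for i
  have "(\<Sum>i<N. z i * z i) = (\<Sum>i<N. (v $ i)\<^sup>2 / S)"
    using \<open>S > 0\<close> by (intro sum.cong refl) (simp add: z_def power2_eq_square)
  also have "\<dots> = 1" using \<open>S > 0\<close> by (simp add: S_def flip: sum_divide_distrib)
  finally have 1: "(\<Sum>i<N. z i * z i) = 1" .
  have "(\<Sum>i<N. r j i * z i) = 0" if "j < k" for j
  proof -
    have "(A *\<^sub>v v) $ j = (\<Sum>i<N. r j i * v $ i)"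
      using that assms v(1) by (auto simp: A_def scalar_prod_def atLeast0LessThan intro!: sum.cong)
    then have "(\<Sum>i<N. r j i * v $ i) = 0" using v(3) that assms by simp
    then show ?thesis by (simp add: z_def flip: sum_divide_distrib)
  qed
  with 1 show ?thesis by blast
qed

text \<open>For a square system uniqueness gives existence: a trivial kernel means a nonzero
  determinant, hence a right inverse.\<close>

lemma exists_solution:
  fixes G :: "nat \<Rightarrow> nat \<Rightarrow> real"
  assumes inj: "\<And>z. (\<forall>j<k. (\<Sum>i<k. G j i * z i) = 0) \<Longrightarrow> \<forall>i<k. z i = 0"
  shows "\<exists>a. \<forall>j<k. (\<Sum>i<k. G j i * a i) = b j"
proof -
  define A where "A = mat k k (\<lambda>(j, i). G j i)"
  have A: "A \<in> carrier_mat k k" by (simp add: A_def)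
  have Av: "(A *\<^sub>v v) $ j = (\<Sum>i<k. G j i * v $ i)" if "j < k" "v \<in> carrier_vec k" for j v
    using that by (auto simp: A_def scalar_prod_def atLeast0LessThan intro!: sum.cong)
  have "det A \<noteq> 0"
  proof
    assume "det A = 0"
    then obtain v where v: "v \<in> carrier_vec k" "v \<noteq> 0\<^sub>v k" "A *\<^sub>v v = 0\<^sub>v k"
      using det_0_iff_vec_prod_zero_field[OF A] by auto
    then have "\<forall>j<k. (\<Sum>i<k. G j i * v $ i) = 0" using Av by force
    then have "\<forall>i<k. v $ i = 0" using inj by blast
    then show False using v(1,2) by auto
  qed
  then obtain B where B: "B \<in> carrier_mat k k" "A * B = 1\<^sub>m k"
    using det_non_zero_imp_unit[OF A] by (auto simp: Units_def ring_mat_def)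
  define a where "a = B *\<^sub>v vec k b"
  have "A *\<^sub>v a = (A * B) *\<^sub>v vec k b"
    unfolding a_def using A B(1) by (intro assoc_mult_mat_vec[symmetric]) auto
  then have "A *\<^sub>v a = vec k b" using B by simp
  moreover have "a \<in> carrier_vec k" using B(1) by (simp add: a_def)
  ultimately have "\<forall>j<k. (\<Sum>i<k. G j i * a $ i) = b j" using Av[of _ a] by simp
  then show ?thesis by blast
qed

text \<open>Diagonal dominance: the equation at an index where \<open>\<bar>a i\<bar>\<close>
  attains its maximum \<open>M\<close> gives \<open>M \<le> \<beta> + M / 4\<close>. With
  \<open>\<beta> = 0\<close> this yields injectivity, with \<open>\<beta> > 0\<close> a bound on the
  coefficients.\<close>

lemma near_identity_bound:
  fixes g :: "nat \<Rightarrow> nat \<Rightarrow> real"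
  assumes small: "\<And>j i. j < k \<Longrightarrow> i < k \<Longrightarrow> \<bar>g j i\<bar> \<le> 1 / (4 * real m)" and "k \<le> m"
    and eq: "\<And>j. j < k \<Longrightarrow> (\<Sum>i<k. (of_bool (j = i) - g j i) * a i) = b j"
    and b: "\<And>j. j < k \<Longrightarrow> \<bar>b j\<bar> \<le> \<beta>"
    and "j < k"
  shows "\<bar>a j\<bar> \<le> 2 * \<beta>"
proof -
  define M where "M = Max ((\<lambda>i. \<bar>a i\<bar>) ` {..<k})"
  have fin: "finite ((\<lambda>i. \<bar>a i\<bar>) ` {..<k})" "(\<lambda>i. \<bar>a i\<bar>) ` {..<k} \<noteq> {}"
    using \<open>j < k\<close> by auto
  have le: "\<bar>a i\<bar> \<le> M" if "i < k" for i using fin that unfolding M_def by (intro Max_ge) auto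
  obtain i0 where i0: "i0 < k" "\<bar>a i0\<bar> = M" using Max_in[OF fin] unfolding M_def by auto
  have "(\<Sum>i<k. (of_bool (i0 = i) - g i0 i) * a i) = a i0 - (\<Sum>i<k. g i0 i * a i)"
    using i0(1) by (simp add: left_diff_distrib sum_subtractf of_bool_def if_distrib[of "\<lambda>x. x * _"] cong: if_cong)
  with eq[OF i0(1)] have "a i0 = b i0 + (\<Sum>i<k. g i0 i * a i)" by linarith
  then have "M \<le> \<bar>b i0\<bar> + \<bar>\<Sum>i<k. g i0 i * a i\<bar>" using i0(2) by linarith
  also have "\<bar>\<Sum>i<k. g i0 i * a i\<bar> \<le> (\<Sum>i<k. \<bar>g i0 i * a i\<bar>)" by (rule sum_abs)
  also have "\<dots> \<le> (\<Sum>i<k. 1 / (4 * real m) * M)"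
    unfolding abs_mult using small le i0(1) by (intro sum_mono mult_mono) auto
  also have "\<dots> = real k / (4 * real m) * M" by simp
  also have "\<dots> \<le> 1 / 4 * M"
    using \<open>k \<le> m\<close> i0 by (intro mult_right_mono) (auto simp: field_simps)
  finally have "M \<le> \<beta> + 1/4 * M" using b[OF i0(1)] by linarith
  moreover have "M \<ge> 0" using i0 by auto
  ultimately show ?thesis using le[OF \<open>j < k\<close>] by linarith
qed

text \<open>The vectors are built one at a time: the prescribed inner products with the previous
  vectors determine a component in their span, which is short because \<open>g\<close> is small; the
  remaining length is supplied by a direction orthogonal to that span.\<close>

lemma exists_gram_realization:
  fixes g :: "nat \<Rightarrow> nat \<Rightarrow> real"
  assumes sym: "\<And>j i. g j i = g i j"
    and small: "\<And>j i. j < m \<Longrightarrow> i < m \<Longrightarrow> \<bar>g j i\<bar> \<le> 1 / (4 * real m)"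
  shows "\<exists>c. \<forall>j<m. \<forall>k<m. (\<Sum>i<m. c j i * c k i) = of_bool (j = k) - g j k"
proof -
  have "k \<le> m \<Longrightarrow> \<exists>c. \<forall>j<k. \<forall>l<k. (\<Sum>i<m. c j i * c l i) = of_bool (j = l) - g j l" for k
  proof (induction k)
    case 0
    then show ?case by auto
  next
    case (Suc k)
    then obtain c where c: "\<And>j l. j < k \<Longrightarrow> l < k \<Longrightarrow> (\<Sum>i<m. c j i * c l i) = of_bool (j = l) - g j l"
      by auto
    have km: "k < m" using Suc by simp
    have sm: "\<bar>g j i\<bar> \<le> 1 / (4 * real m)" if "j \<le> k" "i \<le> k" for i j
      using that km by (intro small) auto
    \<comment> \<open>These are the equations for the coefficients of the new vector's component in
      the span of the old ones; their matrix is the Gram matrix of the old vectors.\<close>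
    have "\<exists>a. \<forall>j<k. (\<Sum>i<k. (of_bool (j = i) - g j i) * a i) = - g j k"
    proof (rule exists_solution)
      fix z :: "nat \<Rightarrow> real"
      assume "\<forall>j<k. (\<Sum>i<k. (of_bool (j = i) - g j i) * z i) = 0"
      then have "\<bar>z j\<bar> \<le> 2 * 0" if "j < k" for j
        using that km sm by (intro near_identity_bound[where k = k and g = g and m = m and b = "\<lambda>_. 0"]) auto
      then show "\<forall>i<k. z i = 0" by auto
    qed
    then obtain a where a: "\<And>j. j < k \<Longrightarrow> (\<Sum>i<k. (of_bool (j = i) - g j i) * a i) = - g j k"
      by auto
    have abound: "\<bar>a j\<bar> \<le> 2 * (1 / (4 * real m))" if "j < k" for j
      using that km sm by (intro near_identity_bound[where k = k and g = g and m = m, OF _ _ a]) auto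
    obtain z where z: "(\<Sum>i<m. z i * z i) = 1" "\<And>j. j < k \<Longrightarrow> (\<Sum>i<m. c j i * z i) = 0"
      using exists_unit_orthogonal[OF km, of c] by auto
    define y where "y i = (\<Sum>j<k. a j * c j i)" for i
    have cy: "(\<Sum>i<m. c j i * y i) = - g j k" if "j < k" for j
    proof -
      have "(\<Sum>i<m. c j i * y i) = (\<Sum>l<k. \<Sum>i<m. a l * (c j i * c l i))"
        unfolding y_def sum_distrib_left by (subst sum.swap) (simp add: mult_ac)
      also have "\<dots> = (\<Sum>l<k. (of_bool (j = l) - g j l) * a l)"
        using c that by (intro sum.cong refl) (metis lessThan_iff mult.commute sum_distrib_left)
      finally show ?thesis using a that by simp
    qed
    have dual: "(\<Sum>i<m. y i * x i) = (\<Sum>l<k. a l * (\<Sum>i<m. c l i * x i))" for x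
      unfolding y_def sum_distrib_right sum_distrib_left by (subst sum.swap) (simp add: mult_ac)
    have yz: "(\<Sum>i<m. y i * z i) = 0" using dual[of z] z(2) by simp
    have yy: "(\<Sum>i<m. y i * y i) = (\<Sum>l<k. a l * (- g l k))" using dual[of y] cy by simp
    \<comment> \<open>Each of the \<open>k\<close> terms is at most \<open>1 / (8 * m * m)\<close>,
      so the span component has squared length at most 1/8.\<close>
    have "(\<Sum>l<k. a l * (- g l k)) \<le> (\<Sum>l<k. 2 * (1 / (4 * real m)) * (1 / (4 * real m)))"
    proof (rule sum_mono)
      fix l assume "l \<in> {..<k}"
      then have "\<bar>a l\<bar> * \<bar>g l k\<bar> \<le> 2 * (1 / (4 * real m)) * (1 / (4 * real m))"
        using abound sm km by (intro mult_mono) auto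
      then show "a l * (- g l k) \<le> 2 * (1 / (4 * real m)) * (1 / (4 * real m))"
        unfolding abs_mult[symmetric] by linarith
    qed
    also have "\<dots> = real k / (8 * real m * real m)" by (simp add: field_simps)
    also have "\<dots> \<le> 1 / 8" 
    proof -
      have "real k * 1 \<le> real m * real m" using km by (intro mult_mono) auto
      then show ?thesis using km by (simp add: field_simps)
    qed
    finally have yle: "(\<Sum>i<m. y i * y i) \<le> 1 / 8" using yy by simp
    have "\<bar>g k k\<bar> \<le> 1 / (4 * real m)" using sm by simp
    also have "\<dots> \<le> 1 / 4" using km by (simp add: field_simps)
    finally have gk: "\<bar>g k k\<bar> \<le> 1 / 4" .
    \<comment> \<open>The length still missing in the orthogonal direction \<open>z\<close>. The
      radicand is at least 1 - 1/4 - 1/8, so the root is genuine.\<close>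
    define t where "t = sqrt (1 - g k k - (\<Sum>i<m. y i * y i))"
    have tt: "t * t = 1 - g k k - (\<Sum>i<m. y i * y i)" using yle gk by (simp add: t_def)
    define x where "x i = y i + t * z i" for i
    have cx: "(\<Sum>i<m. c j i * x i) = - g j k" if "j < k" for j
    proof -
      have "(\<Sum>i<m. c j i * x i) = (\<Sum>i<m. c j i * y i) + t * (\<Sum>i<m. c j i * z i)"
        by (simp add: x_def algebra_simps sum.distrib sum_distrib_left)
      then show ?thesis using cy z(2) that by simp
    qed
    have "(\<Sum>i<m. x i * x i) = (\<Sum>i<m. y i * y i) + 2 * t * (\<Sum>i<m. y i * z i) + t * t * (\<Sum>i<m. z i * z i)"
      by (simp add: x_def algebra_simps sum.distrib sum_distrib_left)
    then have xx: "(\<Sum>i<m. x i * x i) = 1 - g k k" using yz z(1) tt by simp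
    have xc: "(\<Sum>i<m. x i * c j i) = - g k j" if "j < k" for j
      using cx[OF that] sym[of j k] by (simp add: mult.commute)
    show ?case
      by (rule exI[of _ "c(k := x)"]) (auto simp: less_Suc_eq c cx xc xx)
  qed
  from this[of m] show ?thesis by simp
qed

text \<open>The induction runs downwards from \<open>m = N\<close>, where nothing has to be added;
  each step appends a unit vector orthogonal to those already present.\<close>

lemma orthonormal_extension:
  fixes u :: "nat \<Rightarrow> nat \<Rightarrow> real"
  assumes "m \<le> N"
    and "\<And>j k. j < m \<Longrightarrow> k < m \<Longrightarrow> (\<Sum>i<N. u j i * u k i) = of_bool (j = k)"
  shows "\<exists>v. (\<forall>j<m. v j = u j) \<and> (\<forall>j<N. \<forall>k<N. (\<Sum>i<N. v j i * v k i) = of_bool (j = k))"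
  using assms
proof (induction m arbitrary: u rule: inc_induct)
  case base
  then show ?case by auto
next
  case (step m)
  obtain z where z: "(\<Sum>i<N. z i * z i) = 1" "\<And>j. j < m \<Longrightarrow> (\<Sum>i<N. u j i * z i) = 0"
    using exists_unit_orthogonal[OF step.hyps(2), of u] by auto
  have "(\<Sum>i<N. z i * u j i) = 0" if "j < m" for j
    using z(2)[OF that] by (simp add: mult.commute)
  then have "\<exists>v. (\<forall>j<Suc m. v j = (u(m := z)) j) \<and> (\<forall>j<N. \<forall>k<N. (\<Sum>i<N. v j i * v k i) = of_bool (j = k))"
    using z step.prems by (intro step.IH) (auto simp: less_Suc_eq)
  then obtain v where "\<forall>j<Suc m. v j = (u(m := z)) j"
    "\<forall>j<N. \<forall>k<N. (\<Sum>i<N. v j i * v k i) = of_bool (j = k)" by auto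
  then show ?case by (intro exI[of _ v]) (auto simp: less_Suc_eq)
qed

lemma unitary_of_orthonormal:
  fixes v :: "nat \<Rightarrow> nat \<Rightarrow> real"
  assumes "\<And>j k. j < N \<Longrightarrow> k < N \<Longrightarrow> (\<Sum>i<N. v j i * v k i) = of_bool (j = k)"
  shows "unitary N (mat N N (\<lambda>(i, j). complex_of_real (v j i)))"
proof -
  let ?U = "mat N N (\<lambda>(i, j). complex_of_real (v j i))"
  have adj: "mat_adjoint ?U = mat N N (\<lambda>(i, j). complex_of_real (v i j))"
    by (intro eq_matI) (auto simp: mat_adjoint_def mat_of_rows_def conjugate_complex_def)
  have "mat_adjoint ?U * ?U = 1\<^sub>m N"
  proof (rule eq_matI)
    fix i j assume "i < dim_row (1\<^sub>m N)" "j < dim_col (1\<^sub>m N)"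
    then have ij: "i < N" "j < N" by auto
    then have "(mat_adjoint ?U * ?U) $$ (i, j) = complex_of_real (\<Sum>l<N. v i l * v j l)"
      unfolding adj by (simp add: scalar_prod_def atLeast0LessThan)
    then show "(mat_adjoint ?U * ?U) $$ (i, j) = 1\<^sub>m N $$ (i, j)" using ij assms by simp
  qed (auto simp: adj)
  moreover from this have "?U * mat_adjoint ?U = 1\<^sub>m N"
    by (intro mat_mult_left_right_inverse[of "mat_adjoint ?U"]) (auto simp: adj)
  ultimately show ?thesis by (simp add: unitary_def)
qed

lemma exists_unitary_extension:
  fixes u :: "nat \<Rightarrow> nat \<Rightarrow> real"
  assumes "m \<le> N"
    and "\<And>j k. j < m \<Longrightarrow> k < m \<Longrightarrow> (\<Sum>i<N. u j i * u k i) = of_bool (j = k)"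
  shows "\<exists>U. unitary N U \<and> (\<forall>i<N. \<forall>j<m. U $$ (i, j) = complex_of_real (u j i))"
proof -
  obtain v where "\<forall>j<m. v j = u j"
    "\<forall>j<N. \<forall>k<N. (\<Sum>i<N. v j i * v k i) = of_bool (j = k)"
    using orthonormal_extension[OF assms] by auto
  then show ?thesis
    using \<open>m \<le> N\<close> by (intro exI[of _ "mat N N (\<lambda>(i, j). complex_of_real (v j i))"])
      (auto intro: unitary_of_orthonormal)
qed

section \<open>Machines with restart\<close>

lemma integrable_measure_pmf_bounded:
  fixes f :: "'a \<Rightarrow> real"
  assumes "\<And>x. x \<in> set_pmf p \<Longrightarrow> \<bar>f x\<bar> \<le> B"
  shows "integrable (measure_pmf p) f"
  using assms by (intro measure_pmf.integrable_const_bound[where B = B]) (auto simp: AE_measure_pmf_iff)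

lemma expectation_mono_pmf:
  fixes f g :: "'a \<Rightarrow> real"
  assumes "\<And>x. x \<in> set_pmf p \<Longrightarrow> f x \<le> g x"
    and "\<And>x. x \<in> set_pmf p \<Longrightarrow> \<bar>f x\<bar> \<le> B" "\<And>x. x \<in> set_pmf p \<Longrightarrow> \<bar>g x\<bar> \<le> C"
  shows "measure_pmf.expectation p f \<le> measure_pmf.expectation p g"
  using assms by (intro integral_mono_AE integrable_measure_pmf_bounded) (auto simp: AE_measure_pmf_iff)

lemma expectation_cong_pmf:
  fixes f g :: "'a \<Rightarrow> real"
  assumes "\<And>x. x \<in> set_pmf p \<Longrightarrow> f x = g x"
  shows "measure_pmf.expectation p f = measure_pmf.expectation p g"
  using assms by (intro integral_cong_AE) (auto simp: AE_measure_pmf_iff)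

lemma abs_expectation_le:
  fixes f :: "'a \<Rightarrow> real"
  assumes "\<And>x. x \<in> set_pmf p \<Longrightarrow> \<bar>f x\<bar> \<le> B"
  shows "\<bar>measure_pmf.expectation p f\<bar> \<le> B"
proof -
  have "\<bar>measure_pmf.expectation p f\<bar> \<le> measure_pmf.expectation p (\<lambda>x. \<bar>f x\<bar>)"
    by (rule integral_abs_bound)
  also have "\<dots> \<le> B"
    using assms by (intro measure_pmf.integral_le_const integrable_measure_pmf_bounded[where B = B])
      (auto simp: AE_measure_pmf_iff)
  finally show ?thesis .
qed

lemma expectation_bind_pmf_bounded:
  fixes f :: "'b \<Rightarrow> real"
  assumes "\<And>x. \<bar>f x\<bar> \<le> B"
  shows "measure_pmf.expectation (bind_pmf p q) f =
    measure_pmf.expectation p (\<lambda>x. measure_pmf.expectation (q x) f)"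
  unfolding measure_pmf_bind using assms
  by (intro integral_bind[where K = "count_space UNIV" and B = B and B' = 1])
    (auto intro: measure_pmf.finite_measure measure_pmf_in_subprob_algebra simp: measure_pmf.emeasure_space_1)

text \<open>The expected payoff of the rest of the current round if ending it in kind
  \<open>k\<close> pays \<open>v k\<close>. General payoffs are allowed because the martingales and
  potentials below assign a credit to a restart.\<close>

primrec round_value ::
  "('a tape_symbol \<Rightarrow> 'c \<Rightarrow> (kind \<times> 'c) pmf) \<Rightarrow> (kind \<Rightarrow> real) \<Rightarrow> 'a tape_symbol list \<Rightarrow> 'c \<Rightarrow> real"
  where
  "round_value \<delta> v [] c = 0"
| "round_value \<delta> v (\<sigma> # u) c = measure_pmf.expectation (\<delta> \<sigma> c)
     (\<lambda>(k, c'). if k = Nonhalting then round_value \<delta> v u c' else v k)"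

definition round_prob ::
  "('a tape_symbol \<Rightarrow> 'c \<Rightarrow> (kind \<times> 'c) pmf) \<Rightarrow> kind \<Rightarrow> 'a tape_symbol list \<Rightarrow> 'c \<Rightarrow> real" where
  "round_prob \<delta> k = round_value \<delta> (\<lambda>k'. of_bool (k' = k))"

lemma round_prob_Nil [simp]: "round_prob \<delta> k [] c = 0"
  by (simp add: round_prob_def)

lemma abs_round_value_le:
  assumes "\<And>k. \<bar>v k\<bar> \<le> B"
  shows "\<bar>round_value \<delta> v u c\<bar> \<le> B"
proof (induction u arbitrary: c)
  case Nil
  then show ?case using assms[of Accepting] by simp
next
  case (Cons \<sigma> u)
  then show ?case using assms by (auto intro!: abs_expectation_le)
qed

text \<open>Bochner integrals are additive only on integrable functions; the bounds on the payoffs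
  supply integrability at every level of the recursion.\<close>

lemma round_value_linear:
  assumes "\<And>k. \<bar>v k\<bar> \<le> B" "\<And>k. \<bar>v' k\<bar> \<le> B'"
  shows "round_value \<delta> (\<lambda>k. a * v k + b * v' k) u c = a * round_value \<delta> v u c + b * round_value \<delta> v' u c"
proof (induction u arbitrary: c)
  case Nil
  then show ?case by simp
next
  case (Cons \<sigma> u)
  let ?f = "\<lambda>v (k, c'). if k = Nonhalting then round_value \<delta> v u c' else v k"
  have int: "integrable (\<delta> \<sigma> c) (?f v)" "integrable (\<delta> \<sigma> c) (?f v')"
    using assms abs_round_value_le[of v, OF assms(1)] abs_round_value_le[of v', OF assms(2)]
    by (auto intro!: integrable_measure_pmf_bounded)
  have "?f (\<lambda>k. a * v k + b * v' k) = (\<lambda>x. a * ?f v x + b * ?f v' x)"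
    by (auto simp: fun_eq_iff Cons)
  then show ?case using int by simp
qed

lemma round_prob_nonneg: "0 \<le> round_prob \<delta> k u c"
  unfolding round_prob_def
proof (induction u arbitrary: c)
  case (Cons \<sigma> u)
  then show ?case by (auto intro!: Bochner_Integration.integral_nonneg)
qed simp

lemma UNIV_kind: "UNIV = {Nonhalting, Accepting, Rejecting, Restarting}"
proof -
  have "k \<in> {Nonhalting, Accepting, Rejecting, Restarting}" for k by (cases k) auto
  then show ?thesis by blast
qed

lemma finite_kind [simp]: "finite (A :: kind set)"
  by (rule finite_subset[OF subset_UNIV]) (simp add: UNIV_kind)

lemma bounded_kind_fun: "\<bar>v k\<bar> \<le> Max (range (\<lambda>k. \<bar>v k\<bar>))" for v :: "kind \<Rightarrow> real"
  by (intro Max_ge) auto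

text \<open>By linearity every payoff decomposes into the indicators of the three kinds that end a
  round, so three probabilities determine all round values.\<close>

lemma round_value_eq:
  assumes "v Nonhalting = 0"
  shows "round_value \<delta> v u c = v Accepting * round_prob \<delta> Accepting u c +
    v Rejecting * round_prob \<delta> Rejecting u c + v Restarting * round_prob \<delta> Restarting u c"
proof -
  let ?e = "\<lambda>k k'. of_bool (k' = k) :: real"
  have lin: "round_value \<delta> (\<lambda>k. a * f k + b * g k) u c = a * round_value \<delta> f u c + b * round_value \<delta> g u c"
    for a b f g using round_value_linear[OF bounded_kind_fun bounded_kind_fun] .
  \<comment> \<open>The factor 1 brings the three-term sum into the binary shape of
    \<open>lin\<close>, which is then used twice.\<close>
  have "v = (\<lambda>k. 1 * (v Accepting * ?e Accepting k + v Rejecting * ?e Rejecting k) + v Restarting * ?e Restarting k)"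
  proof
    show "v k = 1 * (v Accepting * ?e Accepting k + v Rejecting * ?e Rejecting k) + v Restarting * ?e Restarting k" for k
      by (cases k) (auto simp: assms)
  qed
  then have "round_value \<delta> v u c = round_value \<delta> (\<lambda>k. 1 * (v Accepting * ?e Accepting k +
      v Rejecting * ?e Rejecting k) + v Restarting * ?e Restarting k) u c"
    by (rule arg_cong[where f = "\<lambda>v. round_value \<delta> v u c"])
  then show ?thesis unfolding lin round_prob_def by simp
qed

section \<open>Runs over all rounds: martingales and potentials\<close>

definition running :: "'c config set" where
  "running = {Running i c | i c. True}"

lemma indicator_running [simp]:
  "indicat_real running (Running i c) = 1"
  "indicat_real running Accepted = 0"
  "indicat_real running Rejected = 0"
  by (auto simp: running_def)

lemma expectation_config_step:
  fixes x y :: real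
  assumes "i < length (tape w)"
  shows "measure_pmf.expectation (config_step start \<delta> w (Running i c)) (case_config g x y) =
    measure_pmf.expectation (\<delta> (tape w ! i) c)
      (\<lambda>(k, c'). case k of Nonhalting \<Rightarrow> g (Suc i) c' | Accepting \<Rightarrow> x | Rejecting \<Rightarrow> y
         | Restarting \<Rightarrow> g 0 start)"
proof -
  have "case_config g x y (successor start i p) = (case p of (k, c') \<Rightarrow> case k of Nonhalting \<Rightarrow> g (Suc i) c'
    | Accepting \<Rightarrow> x | Rejecting \<Rightarrow> y | Restarting \<Rightarrow> g 0 start)" for p
    by (cases p; cases "fst p") auto
  then show ?thesis using assms by simp
qed

lemma abs_case_config_le:
  fixes B :: real
  assumes "\<And>i c. \<bar>g i c\<bar> \<le> B" "\<bar>x\<bar> \<le> B" "\<bar>y\<bar> \<le> B"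
  shows "\<bar>case_config g x y s\<bar> \<le> B"
  using assms by (cases s) auto

text \<open>The assumption is \<open>rounds_end\<close> at a single input, so that every result can
  be applied word by word.\<close>

locale restart_run =
  fixes start :: 'c and \<delta> :: "'a tape_symbol \<Rightarrow> 'c \<Rightarrow> (kind \<times> 'c) pmf" and w :: "'a list"
  assumes round_ends: "\<And>t i c. Running i c \<in> set_pmf (run start \<delta> w t) \<Longrightarrow> i < length (tape w)"
begin

abbreviation "E t \<equiv> measure_pmf.expectation (run start \<delta> w t)"
abbreviation "R t \<equiv> measure_pmf.prob (run start \<delta> w t) running"
abbreviation "step \<equiv> config_step start \<delta> w"
abbreviation "tail i \<equiv> drop i (tape w)"
abbreviation "pa \<equiv> round_prob \<delta> Accepting (tape w) start"
abbreviation "pr \<equiv> round_prob \<delta> Rejecting (tape w) start"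
abbreviation "ps \<equiv> round_prob \<delta> Restarting (tape w) start"
abbreviation "N \<equiv> length (tape w)"

lemma expectation_Suc:
  fixes F :: "'c config \<Rightarrow> real"
  assumes "\<And>s. \<bar>F s\<bar> \<le> B"
  shows "E (Suc t) F = E t (\<lambda>s. measure_pmf.expectation (step s) F)"
  by (simp add: expectation_bind_pmf_bounded[OF assms])

text \<open>Induction on the number of unread squares. A reachable configuration never stands beyond
  the tape, so the base case is contradictory and the round must end before it.\<close>

lemma round_prob_sum:
  assumes "Running i c \<in> set_pmf (run start \<delta> w t)"
  shows "round_value \<delta> (\<lambda>k. of_bool (k \<noteq> Nonhalting)) (tail i) c = 1"
  using assms
proof (induction "N - i" arbitrary: i c t)
  case 0
  then show ?case using round_ends by fastforce
next
  case (Suc j)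
  then have i: "i < N" by simp
  let ?v = "\<lambda>k. of_bool (k \<noteq> Nonhalting) :: real"
  have "round_value \<delta> ?v (tail i) c = measure_pmf.expectation (\<delta> (tape w ! i) c)
    (\<lambda>(k, c'). if k = Nonhalting then round_value \<delta> ?v (tail (Suc i)) c' else ?v k)"
    by (simp flip: Cons_nth_drop_Suc[OF i])
  also have "\<dots> = measure_pmf.expectation (\<delta> (tape w ! i) c) (\<lambda>_. 1)"
  proof (rule expectation_cong_pmf, clarify)
    fix k c' assume kc: "(k, c') \<in> set_pmf (\<delta> (tape w ! i) c)"
    have "round_value \<delta> ?v (tail (Suc i)) c' = 1" if "k = Nonhalting"
    proof (rule Suc.hyps)
      show "j = N - Suc i" using Suc.hyps by simp
      show "Running (Suc i) c' \<in> set_pmf (run start \<delta> w (Suc t))"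
        using kc that i by (auto intro!: bexI[OF _ Suc.prems] image_eqI[OF _ kc])
    qed
    then show "(if k = Nonhalting then round_value \<delta> ?v (tail (Suc i)) c' else ?v k) = 1" by simp
  qed
  finally show ?case by simp
qed

lemma ps_eq: "ps = 1 - (pa + pr)"
  using round_prob_sum[of 0 start 0] by (simp add: round_value_eq)

lemma round_value_tail:
  assumes "i < N"
  shows "round_value \<delta> v (tail i) c = measure_pmf.expectation (\<delta> (tape w ! i) c)
    (\<lambda>(k, c'). if k = Nonhalting then round_value \<delta> v (tail (Suc i)) c' else v k)"
  by (simp flip: Cons_nth_drop_Suc[OF assms])

text \<open>The function is the expected payoff of the current round, a restart being credited with
  \<open>v Restarting\<close>. By hypothesis a fresh round is worth exactly this credit, so no step,
  not even a restart, changes the expectation.\<close>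

lemma martingale:
  assumes v: "round_value \<delta> v (tape w) start = v Restarting"
  shows "E t (case_config (\<lambda>i. round_value \<delta> v (tail i)) (v Accepting) (v Rejecting)) = v Restarting"
    (is "E t ?F = _")
proof (induction t)
  case 0
  then show ?case using v by simp
next
  case (Suc t)
  obtain B where B: "\<And>k. \<bar>v k\<bar> \<le> B" using bounded_kind_fun by metis
  have "measure_pmf.expectation (step s) ?F = ?F s" for s
  proof (cases s)
    case (Running i c)
    show ?thesis
    proof (cases "i < N")
      case True
      then show ?thesis unfolding Running expectation_config_step[OF True]
        by (auto simp: round_value_tail v intro!: expectation_cong_pmf split: kind.split)
    qed (simp add: Running)
  qed auto
  then show ?case
    using Suc by (subst expectation_Suc[where B = B]) (auto intro!: abs_case_config_le abs_round_value_le B)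
qed

text \<open>A drift condition: a potential that drops by at least 1 in expectation at each running
  step. Telescoping bounds the sum of \<open>R\<close>, and hence the expected time, from
  above.\<close>

lemma potential_decrease:
  fixes F :: "'c config \<Rightarrow> real"
  assumes bd: "\<And>s. \<bar>F s\<bar> \<le> B"
    and dec: "\<And>s. s \<in> set_pmf (run start \<delta> w t) \<Longrightarrow> measure_pmf.expectation (step s) F \<le> F s - indicator running s"
  shows "E (Suc t) F \<le> E t F - R t"
proof -
  have "E (Suc t) F = E t (\<lambda>s. measure_pmf.expectation (step s) F)"
    by (rule expectation_Suc[OF bd])
  also have "\<dots> \<le> E t (\<lambda>s. F s - indicator running s)"
  proof (rule expectation_mono_pmf[OF dec])
    show "\<bar>measure_pmf.expectation (step s) F\<bar> \<le> B" for s by (rule abs_expectation_le[OF bd])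
    show "\<bar>F s - indicator running s\<bar> \<le> B + 1" for s
      using bd[of s] by (auto simp: indicator_def)
  qed
  also have "\<dots> = E t F - R t"
    by (subst Bochner_Integration.integral_diff) (auto intro!: integrable_measure_pmf_bounded bd)
  finally show ?thesis .
qed

text \<open>The reverse drift condition: a drop of at most 1 per running step, for lower bounds on
  the expected time.\<close>

lemma potential_increase:
  fixes F :: "'c config \<Rightarrow> real"
  assumes bd: "\<And>s. \<bar>F s\<bar> \<le> B"
    and dec: "\<And>s. s \<in> set_pmf (run start \<delta> w t) \<Longrightarrow> measure_pmf.expectation (step s) F \<ge> F s - indicator running s"
  shows "E (Suc t) F \<ge> E t F - R t"
proof -
  have "E t F - R t = E t (\<lambda>s. F s - indicator running s)"
    by (subst Bochner_Integration.integral_diff) (auto intro!: integrable_measure_pmf_bounded bd)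
  also have "\<dots> \<le> E t (\<lambda>s. measure_pmf.expectation (step s) F)"
  proof (rule expectation_mono_pmf[OF dec])
    show "\<bar>measure_pmf.expectation (step s) F\<bar> \<le> B" for s by (rule abs_expectation_le[OF bd])
    show "\<bar>F s - indicator running s\<bar> \<le> B + 1" for s
      using bd[of s] by (auto simp: indicator_def)
  qed
  also have "\<dots> = E (Suc t) F"
    by (rule expectation_Suc[OF bd, symmetric])
  finally show ?thesis .
qed

text \<open>Paying 1 for halting and 0 for restarting makes a fresh round worth 0, so the martingale
  has expectation 0 at all times; it dominates the indicators of \<open>Accepted\<close> and
  \<open>Rejected\<close>.\<close>

lemma no_halt_imp_zero:
  assumes "pa + pr \<le> 0"
  shows "acc_prob start \<delta> w = 0" "rej_prob start \<delta> w = 0"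
proof -
  have pa: "pa = 0" "pr = 0" using assms round_prob_nonneg[of \<delta> _ "tape w" start]
    by (smt (verit))+
  define v where "v k = (of_bool (k = Accepting \<or> k = Rejecting) :: real)" for k
  let ?F = "case_config (\<lambda>i. round_value \<delta> v (tail i)) (v Accepting) (v Rejecting)"
  have EF: "E t ?F = 0" for t using martingale[of v t] by (simp add: v_def round_value_eq pa)
  have F_bd: "\<bar>?F s\<bar> \<le> 1" for s
    by (intro abs_case_config_le abs_round_value_le) (auto simp: v_def)
  have "pmf (run start \<delta> w t) s = 0" if "s \<in> {Accepted, Rejected}" for s t
  proof -
    have "indicat_real {s} s' \<le> ?F s'" for s'
      using that by (cases s') (auto simp: v_def indicator_def round_value_eq round_prob_nonneg)
    then have "E t (indicat_real {s}) \<le> E t ?F"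
      by (rule expectation_mono_pmf[OF _ _ F_bd, where B = 1]) auto
    then show ?thesis using EF[of t] by (simp add: measure_pmf_single)
  qed
  then show "acc_prob start \<delta> w = 0" "rej_prob start \<delta> w = 0"
    by (simp_all add: acc_prob_def rej_prob_def)
qed

end

locale halting_run = restart_run +
  assumes halt_pos: "pa + pr > 0"
begin

text \<open>The potential is an upper bound for the expected remaining time: the rest of the current
  round, plus \<open>N / (pa + pr)\<close> if that round restarts.\<close>

lemma sum_running_le: "(\<Sum>s<t. R s) \<le> N / (pa + pr)"
proof -
  define K where "K = N / (pa + pr)"
  have K: "K \<ge> 0" using halt_pos by (simp add: K_def)
  define v where "v k = K * of_bool (k = Restarting)" for k
  have rv: "round_value \<delta> v u c = K * round_prob \<delta> Restarting u c" for u c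
    by (simp add: round_value_eq v_def)
  have rv_bd: "\<bar>round_value \<delta> v u c\<bar> \<le> K" for u c
    using K by (intro abs_round_value_le) (auto simp: v_def)
  have rv_nonneg: "0 \<le> round_value \<delta> v u c" for u c
    using K by (simp add: rv round_prob_nonneg)
  define g where "g i c = real (N - i) + round_value \<delta> v (tail i) c" for i c
  have g_bd: "\<bar>g i c\<bar> \<le> N + K" for i c
    using rv_bd[of "tail i" c] by (auto simp: g_def)
  \<comment> \<open>\<open>K\<close> is the solution of \<open>K = N + K * ps\<close>: the credit
    for a restart equals the potential of a fresh round.\<close>
  have g0: "g 0 start = K"
    using halt_pos by (simp add: g_def rv ps_eq K_def field_simps)
  let ?F = "case_config g 0 0"
  have F_bd: "\<bar>?F s\<bar> \<le> N + K" for s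
    using K by (intro abs_case_config_le g_bd) auto
  have dec: "measure_pmf.expectation (step s) ?F \<le> ?F s - indicator running s"
    if "s \<in> set_pmf (run start \<delta> w t)" for s t
  proof (cases s)
    case (Running i c)
    then have i: "i < N" using round_ends that by blast
    let ?f = "\<lambda>(k, c'). if k = Nonhalting then round_value \<delta> v (tail (Suc i)) c' else v k"
    have f_bd: "\<bar>?f x\<bar> \<le> K" for x using rv_bd K by (auto simp: v_def split: prod.split)
    have f_int: "integrable (\<delta> (tape w ! i) c) ?f" by (rule integrable_measure_pmf_bounded[OF f_bd])
    have "measure_pmf.expectation (step s) ?F \<le> measure_pmf.expectation (\<delta> (tape w ! i) c) (\<lambda>x. real (N - Suc i) + ?f x)"
      unfolding Running expectation_config_step[OF i]
    proof (rule expectation_mono_pmf[where B = "N + K" and C = "N + K"])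
      show "\<bar>real (N - Suc i) + ?f x\<bar> \<le> N + K" for x using f_bd[of x] by linarith
      show "\<bar>case x of (k, c') \<Rightarrow> case k of Nonhalting \<Rightarrow> g (Suc i) c' | Restarting \<Rightarrow> g 0 start | _ \<Rightarrow> 0\<bar> \<le> N + K" for x
        using g_bd K by (auto split: prod.split kind.split)
      show "(case x of (k, c') \<Rightarrow> case k of Nonhalting \<Rightarrow> g (Suc i) c' | Restarting \<Rightarrow> g 0 start | _ \<Rightarrow> 0)
        \<le> real (N - Suc i) + ?f x" for x
        unfolding g0 by (auto simp: v_def g_def split: prod.split kind.split)
    qed
    also have "\<dots> = real (N - Suc i) + round_value \<delta> v (tail i) c"
      unfolding round_value_tail[OF i]
      using f_int by simp
    also have "\<dots> = ?F s - indicator running s"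
      using i by (simp add: Running g_def)
    finally show ?thesis .
  qed auto
  have "(\<Sum>s<t. R s) + E t ?F \<le> K"
  proof (induction t)
    case 0
    then show ?case by (simp add: g0)
  next
    case (Suc t)
    have "E (Suc t) ?F \<le> E t ?F - R t" by (rule potential_decrease[OF F_bd dec])
    with Suc show ?case unfolding sum.lessThan_Suc by linarith
  qed
  moreover have "E t ?F \<ge> 0"
    by (auto intro!: Bochner_Integration.integral_nonneg simp: g_def rv_nonneg split: config.split)
  ultimately show ?thesis unfolding K_def by linarith
qed

lemma expected_time_eq: "expected_time start \<delta> w = (\<Sum>t. ennreal (R t))"
  by (simp add: expected_time_def running_def)

lemma summable_running: "summable R"
  by (rule bounded_imp_summable[where B = "N / (pa + pr)"])
    (use sum_running_le[of "Suc _"] in \<open>auto simp: lessThan_Suc_atMost\<close>)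

lemma expected_time_suminf: "expected_time start \<delta> w = ennreal (suminf R)"
  unfolding expected_time_eq by (intro suminf_ennreal2 summable_running) auto

lemma expected_time_le: "expected_time start \<delta> w \<le> ennreal (N / (pa + pr))"
  unfolding expected_time_suminf
  by (intro ennreal_leI suminf_le_const summable_running sum_running_le)

lemma running_tendsto_0: "R \<longlonglongrightarrow> 0"
  using summable_running by (rule summable_LIMSEQ_zero)

text \<open>The potential is a lower bound for the expected number of further rounds.\<close>

lemma expected_time_ge: "expected_time start \<delta> w \<ge> ennreal (1 / (pa + pr) - 1)"
proof -
  define K where "K = 1 / (pa + pr)"
  have K: "K \<ge> 0" using halt_pos by (simp add: K_def)
  define v where "v k = K * of_bool (k = Restarting)" for k
  have rv: "round_value \<delta> v u c = K * round_prob \<delta> Restarting u c" for u c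
    by (simp add: round_value_eq v_def)
  have rv_bd: "\<bar>round_value \<delta> v u c\<bar> \<le> K" for u c
    using K by (intro abs_round_value_le) (auto simp: v_def)
  \<comment> \<open>A fresh round has potential \<open>K * ps = K - 1\<close>, whereas its restart
    was credited with \<open>K\<close>; the loss of 1 is covered by the step that caused the
    restart.\<close>
  have g0: "round_value \<delta> v (tape w) start = K - 1"
    using halt_pos by (simp add: rv ps_eq K_def field_simps)
  let ?F = "case_config (\<lambda>i. round_value \<delta> v (tail i)) 0 0"
  have F_bd: "\<bar>?F s\<bar> \<le> K" for s
    using K by (intro abs_case_config_le rv_bd) auto
  have dec: "measure_pmf.expectation (step s) ?F \<ge> ?F s - indicator running s"
    if "s \<in> set_pmf (run start \<delta> w t)" for s t
  proof (cases s)
    case (Running i c)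
    then have i: "i < N" using round_ends that by blast
    let ?f = "\<lambda>(k, c'). if k = Nonhalting then round_value \<delta> v (tail (Suc i)) c' else v k"
    have f_bd: "\<bar>?f x\<bar> \<le> K" for x using rv_bd K by (auto simp: v_def split: prod.split)
    have f_int: "integrable (\<delta> (tape w ! i) c) ?f" by (rule integrable_measure_pmf_bounded[OF f_bd])
    have "?F s - indicator running s = measure_pmf.expectation (\<delta> (tape w ! i) c) (\<lambda>x. ?f x - 1)"
      using f_int by (simp add: Running round_value_tail[OF i])
    also have "\<dots> \<le> measure_pmf.expectation (step s) ?F"
      unfolding Running expectation_config_step[OF i]
    proof (rule expectation_mono_pmf[where C = "K + 1" and B = "K + 1"])
      show "\<bar>?f x - 1\<bar> \<le> K + 1" for x using f_bd[of x] by linarith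
      show "\<bar>case x of (k, c') \<Rightarrow> case k of Nonhalting \<Rightarrow> round_value \<delta> v (tail (Suc i)) c'
        | Restarting \<Rightarrow> round_value \<delta> v (tail 0) start | _ \<Rightarrow> 0\<bar> \<le> K + 1" for x
        using order_trans[OF rv_bd, of "K + 1"] K by (auto split: prod.split kind.split)
      show "?f x - 1 \<le> (case x of (k, c') \<Rightarrow> case k of Nonhalting \<Rightarrow> round_value \<delta> v (tail (Suc i)) c'
        | Restarting \<Rightarrow> round_value \<delta> v (tail 0) start | _ \<Rightarrow> 0)" for x
        by (auto simp: v_def g0 split: prod.split kind.split)
    qed
    finally show ?thesis .
  qed auto
  have sum: "(\<Sum>s<t. R s) \<ge> K - 1 - E t ?F" for t
  proof (induction t)
    case 0
    then show ?case by (simp add: g0)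
  next
    case (Suc t)
    have "E (Suc t) ?F \<ge> E t ?F - R t" by (rule potential_increase[OF F_bd dec])
    with Suc show ?case unfolding sum.lessThan_Suc by linarith
  qed
  have "K - 1 - K * R t \<le> (\<Sum>s<t. R s)" for t
  proof -
    \<comment> \<open>The potential is at most \<open>K\<close> while running and 0 after halting,
      so its expectation tends to 0 together with \<open>R\<close>.\<close>
    have "E t ?F \<le> E t (\<lambda>s. K * indicator running s)"
    proof (rule expectation_mono_pmf[where B = K and C = K])
      show "?F s \<le> K * indicator running s" for s
        using rv_bd by (cases s) (auto simp: abs_le_iff)
    qed (use F_bd K in \<open>auto simp: indicator_def\<close>)
    then show ?thesis using sum[of t] by simp
  qed
  moreover have "(\<lambda>t. K - 1 - K * R t) \<longlonglongrightarrow> K - 1 - K * 0"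
    by (rule tendsto_diff[OF tendsto_const tendsto_mult[OF tendsto_const running_tendsto_0]])
  moreover have "(\<lambda>t. \<Sum>s<t. R s) \<longlonglongrightarrow> suminf R"
    using summable_running by (rule summable_LIMSEQ)
  ultimately have "K - 1 \<le> suminf R"
    by (intro LIMSEQ_le[of "\<lambda>t. K - 1 - K * R t"]) auto
  then show ?thesis unfolding expected_time_suminf K_def by (rule ennreal_leI)
qed

text \<open>The restart credit \<open>z\<close> is chosen with \<open>z = pa + z * ps\<close> (or
  with \<open>pr\<close> for \<open>pa\<close>), so the martingale keeps the value \<open>z\<close>.
  It differs from the indicator of the desired answer by at most 1, and only on running
  configurations; as \<open>R\<close> tends to 0, the probability of that answer tends to
  \<open>z\<close>.\<close>

lemma acceptance_limits:
  "acc_prob start \<delta> w = pa / (pa + pr)" "rej_prob start \<delta> w = pr / (pa + pr)"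
proof -
  have lim: "(\<lambda>t. pmf (run start \<delta> w t) s) \<longlonglongrightarrow> z"
    if z: "0 \<le> z" "z \<le> 1" and s: "s \<in> {Accepted, Rejected}"
      and v: "v = (\<lambda>k. case k of Nonhalting \<Rightarrow> 0 | Accepting \<Rightarrow> of_bool (s = Accepted) |
        Rejecting \<Rightarrow> of_bool (s = Rejected) | Restarting \<Rightarrow> z)"
      and fixed: "round_value \<delta> v (tape w) start = z" for s z v
  proof -
    let ?F = "case_config (\<lambda>i. round_value \<delta> v (tail i)) (v Accepting) (v Rejecting)"
    have v_bd: "\<bar>v k\<bar> \<le> 1" for k using z by (auto simp: v split: kind.split)
    have EF: "E t ?F = z" for t using martingale[of v t] fixed v by simp
    have rv_bd: "\<bar>round_value \<delta> v u c\<bar> \<le> 1" for u c by (rule abs_round_value_le[OF v_bd])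
    have F_bd: "\<bar>?F s\<bar> \<le> 1" for s
      by (intro abs_case_config_le rv_bd v_bd)
    have rv_nonneg: "0 \<le> round_value \<delta> v u c" for u c
      using z by (subst round_value_eq) (auto simp: v round_prob_nonneg)
    have ind: "indicat_real {s} s' \<le> ?F s'" "?F s' \<le> indicat_real {s} s' + indicator running s'" for s'
      using s rv_nonneg rv_bd by (cases s'; force simp: v indicator_def running_def abs_le_iff)+
    have P: "pmf (run start \<delta> w t) s = E t (indicat_real {s})" for t
      by (simp add: measure_pmf_single)
    have up: "pmf (run start \<delta> w t) s \<le> z" for t
    proof -
      have "E t (indicat_real {s}) \<le> E t ?F"
        by (rule expectation_mono_pmf[OF ind(1) _ F_bd, where B = 1]) auto
      then show ?thesis unfolding P EF .
    qed
    have low: "z \<le> pmf (run start \<delta> w t) s + R t" for t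
    proof -
      have "E t ?F \<le> E t (\<lambda>s'. indicat_real {s} s' + indicator running s')"
        by (rule expectation_mono_pmf[OF ind(2) F_bd, where C = 2]) (auto simp: indicator_def)
      also have "\<dots> = pmf (run start \<delta> w t) s + R t"
        unfolding P by (subst Bochner_Integration.integral_add)
          (auto intro!: integrable_measure_pmf_bounded[where B = 1] simp: indicator_def)
      finally show ?thesis unfolding EF .
    qed
    have "(\<lambda>t. z - R t) \<longlonglongrightarrow> z - 0" by (rule tendsto_diff[OF tendsto_const running_tendsto_0])
    then have "(\<lambda>t. z - R t) \<longlonglongrightarrow> z" unfolding diff_zero .
    moreover have "z - R t \<le> pmf (run start \<delta> w t) s" for t using low[of t] by linarith
    ultimately show ?thesis using up
      by (elim tendsto_sandwich[rotated 2, OF _ tendsto_const]) (auto intro: always_eventually)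
  qed
  have nn: "pa \<ge> 0" "pr \<ge> 0" by (simp_all add: round_prob_nonneg)
  show "acc_prob start \<delta> w = pa / (pa + pr)"
    unfolding acc_prob_def using halt_pos nn
    by (intro limI lim[OF _ _ _ refl]) (auto simp: round_value_eq ps_eq field_simps)
  show "rej_prob start \<delta> w = pr / (pa + pr)"
    unfolding rej_prob_def using halt_pos nn
    by (intro limI lim[OF _ _ _ refl]) (auto simp: round_value_eq ps_eq field_simps)
qed

end

text \<open>At time 0 the machine is still running. This later absorbs the \<open>- 1\<close> in the
  lower bound on the expected time.\<close>

lemma expected_time_ge_1: "expected_time start \<delta> w \<ge> 1"
proof -
  have "(1 :: ennreal) = (\<Sum>t<1. ennreal (measure_pmf.prob (run start \<delta> w t) {Running i c | i c. True}))"
    by (simp add: indicator_def)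
  also have "\<dots> \<le> expected_time start \<delta> w"
    unfolding expected_time_def by (rule sum_le_suminf) auto
  finally show ?thesis .
qed

section \<open>Quantum automata computing products of real matrices\<close>

lemma sum_lessThan_add:
  fixes f :: "nat \<Rightarrow> 'b :: comm_monoid_add"
  shows "(\<Sum>i<m + k. f i) = (\<Sum>i<m. f i) + (\<Sum>i<k. f (m + i))"
  by (induction k) (simp_all add: add.assoc)

text \<open>The rows \<open>m, \<dots>, 2 m - 1\<close> absorb the defect of the prescribed entries from an isometry.\<close>

lemma exists_unitary_with_block:
  fixes x :: "nat \<Rightarrow> nat \<Rightarrow> real"
  assumes small: "\<And>j k. j < m \<Longrightarrow> k < m \<Longrightarrow>
    \<bar>(\<Sum>i<m. x i j * x i k) + x (2 * m) j * x (2 * m) k + x (2 * m + 1) j * x (2 * m + 1) k\<bar> \<le> 1 / (4 * real m)"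
  shows "\<exists>U. unitary (2 * m + 2) U \<and>
    (\<forall>i j. j < m \<and> i < 2 * m + 2 \<and> (i < m \<or> 2 * m \<le> i) \<longrightarrow> U $$ (i, j) = complex_of_real (x i j))"
proof -
  define g where "g j k = (\<Sum>i<m. x i j * x i k) + x (2 * m) j * x (2 * m) k + x (2 * m + 1) j * x (2 * m + 1) k" for j k
  obtain c where c: "\<And>j k. j < m \<Longrightarrow> k < m \<Longrightarrow> (\<Sum>i<m. c j i * c k i) = of_bool (j = k) - g j k"
  proof -
    have "g j k = g k j" for j k by (simp add: g_def mult.commute)
    from exists_gram_realization[of g m, OF this small[folded g_def]] show ?thesis
      using that by blast
  qed
  define u where "u j i = (if m \<le> i \<and> i < 2 * m then c j (i - m) else x i j)" for j i
  have "(\<Sum>i<2 * m + 2. u j i * u k i) = of_bool (j = k)" if "j < m" "k < m" for j k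
  proof -
    have "(\<Sum>i<2 * m + 2. u j i * u k i) = (\<Sum>i<m + m. u j i * u k i) + u j (2 * m) * u k (2 * m)
        + u j (2 * m + 1) * u k (2 * m + 1)"
      by (simp add: mult_2 numeral_2_eq_2)
    also have "(\<Sum>i<m + m. u j i * u k i) = (\<Sum>i<m. x i j * x i k) + (\<Sum>i<m. c j i * c k i)"
      unfolding sum_lessThan_add by (simp add: u_def)
    finally show ?thesis using c[OF that] by (simp add: u_def g_def)
  qed
  then obtain U where "unitary (2 * m + 2) U" "\<forall>i<2 * m + 2. \<forall>j<m. U $$ (i, j) = complex_of_real (u j i)"
    using exists_unitary_extension[of m "2 * m + 2" u] by auto
  then show ?thesis by (intro exI[of _ U]) (auto simp: u_def)
qed

section \<open>Norms, projections and one measured quantum step\<close>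

lemma norm_sq_nonneg: "0 \<le> norm_sq v"
  by (simp add: norm_sq_def sum_nonneg)

lemma norm_sq_unitary:
  assumes U: "unitary n U" and v: "v \<in> carrier_vec n"
  shows "norm_sq (U *\<^sub>v v) = norm_sq v"
proof -
  have Uc: "U \<in> carrier_mat n n" and UU: "mat_adjoint U * U = 1\<^sub>m n"
    using U by (auto simp: unitary_def)
  have orth: "(\<Sum>i<n. U $$ (i, j) * cnj (U $$ (i, k))) = of_bool (j = k)" if "j < n" "k < n" for j k
  proof -
    have "(mat_adjoint U * U) $$ (k, j) = (\<Sum>i<n. U $$ (i, j) * cnj (U $$ (i, k)))"
      using that Uc by (auto simp: mat_adjoint_def scalar_prod_def atLeast0LessThan mult.commute intro!: sum.cong)
    then show ?thesis using that by (auto simp: UU)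
  qed
  have Uv: "(U *\<^sub>v v) $ i = (\<Sum>j<n. U $$ (i, j) * v $ j)" if "i < n" for i
    using that Uc v by (auto simp: scalar_prod_def atLeast0LessThan intro!: sum.cong)
  have "complex_of_real (norm_sq (U *\<^sub>v v)) = (\<Sum>i<n. (U *\<^sub>v v) $ i * cnj ((U *\<^sub>v v) $ i))"
    using Uc unfolding norm_sq_def of_real_sum complex_norm_square by simp
  also have "\<dots> = (\<Sum>i<n. \<Sum>j<n. \<Sum>k<n. v $ j * cnj (v $ k) * (U $$ (i, j) * cnj (U $$ (i, k))))"
    by (simp add: Uv sum_product mult_ac)
  also have "\<dots> = (\<Sum>j<n. \<Sum>k<n. \<Sum>i<n. v $ j * cnj (v $ k) * (U $$ (i, j) * cnj (U $$ (i, k))))"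
    by (rule trans[OF sum.swap sum.cong[OF refl sum.swap]])
  also have "\<dots> = (\<Sum>j<n. \<Sum>k<n. v $ j * cnj (v $ k) * of_bool (j = k))"
    by (simp add: orth flip: sum_distrib_left)
  also have "\<dots> = (\<Sum>j<n. v $ j * cnj (v $ j))"
    by (simp add: of_bool_def if_distrib[of "\<lambda>x. _ * x"] cong: if_cong)
  also have "\<dots> = complex_of_real (norm_sq v)"
    using v unfolding norm_sq_def of_real_sum complex_norm_square by simp
  finally show ?thesis by (simp only: of_real_eq_iff)
qed

lemma dim_normalize: "dim_vec (normalize_vec v) = dim_vec v"
  by (simp add: normalize_vec_def)

lemma normalize_index: "i < dim_vec v \<Longrightarrow> normalize_vec v $ i = v $ i / complex_of_real (sqrt (norm_sq v))"
  by (simp add: normalize_vec_def)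

lemma norm_sq_normalize:
  assumes "norm_sq v \<noteq> 0"
  shows "norm_sq (normalize_vec v) = 1"
proof -
  have "norm_sq (normalize_vec v) = (\<Sum>i<dim_vec v. (cmod (v $ i))\<^sup>2 / norm_sq v)"
    unfolding norm_sq_def[of "normalize_vec v"] dim_normalize
    by (intro sum.cong refl) (simp add: normalize_index norm_divide power_divide norm_sq_nonneg)
  also have "\<dots> = 1" using assms by (simp add: norm_sq_def flip: sum_divide_distrib)
  finally show ?thesis .
qed

lemma norm_sq_kind_proj:
  "norm_sq (kind_proj M k v) = (\<Sum>i<qfa_size M. if qfa_kind M i = k then (cmod (v $ i))\<^sup>2 else 0)"
  by (auto simp: norm_sq_def kind_proj_def intro!: sum.cong)

lemma sum_norm_sq_kind_proj:
  assumes "v \<in> carrier_vec (qfa_size M)"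
  shows "(\<Sum>k\<in>UNIV. norm_sq (kind_proj M k v)) = norm_sq v"
  unfolding norm_sq_kind_proj using assms by (subst sum.swap) (simp add: norm_sq_def)

context
  fixes M :: "'a qfa" and \<sigma> \<psi>
  assumes U: "unitary (qfa_size M) (qfa_op M \<sigma>)"
    and \<psi>: "\<psi> \<in> carrier_vec (qfa_size M)" "norm_sq \<psi> = 1"
begin

text \<open>Unitarity preserves the norm and the four projections split it, so the weights sum to 1
  and \<open>embed_pmf\<close> really has them as its mass function.\<close>

lemma pmf_kind: "pmf (embed_pmf (\<lambda>k. norm_sq (kind_proj M k (qfa_op M \<sigma> *\<^sub>v \<psi>)))) k =
  norm_sq (kind_proj M k (qfa_op M \<sigma> *\<^sub>v \<psi>))"
proof (rule pmf_embed_pmf)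
  have "qfa_op M \<sigma> *\<^sub>v \<psi> \<in> carrier_vec (qfa_size M)"
    using U \<psi> by (auto simp: unitary_def intro: mult_mat_vec_carrier)
  then have "(\<Sum>k\<in>UNIV. norm_sq (kind_proj M k (qfa_op M \<sigma> *\<^sub>v \<psi>))) = 1"
    using norm_sq_unitary[OF U \<psi>(1)] \<psi>(2) by (simp add: sum_norm_sq_kind_proj)
  then show "(\<integral>\<^sup>+k. ennreal (norm_sq (kind_proj M k (qfa_op M \<sigma> *\<^sub>v \<psi>))) \<partial>count_space UNIV) = 1"
    by (simp add: nn_integral_count_space_finite norm_sq_nonneg sum_ennreal)
qed (rule norm_sq_nonneg)

lemma set_qfa_step:
  assumes "(k, \<psi>') \<in> set_pmf (qfa_step M \<sigma> \<psi>)"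
  shows "norm_sq (kind_proj M k (qfa_op M \<sigma> *\<^sub>v \<psi>)) \<noteq> 0"
    and "\<psi>' = normalize_vec (kind_proj M k (qfa_op M \<sigma> *\<^sub>v \<psi>))"
proof -
  have "k \<in> set_pmf (embed_pmf (\<lambda>k. norm_sq (kind_proj M k (qfa_op M \<sigma> *\<^sub>v \<psi>))))"
    and "\<psi>' = normalize_vec (kind_proj M k (qfa_op M \<sigma> *\<^sub>v \<psi>))"
    using assms unfolding qfa_step_def set_map_pmf by auto
  then show "norm_sq (kind_proj M k (qfa_op M \<sigma> *\<^sub>v \<psi>)) \<noteq> 0"
    and "\<psi>' = normalize_vec (kind_proj M k (qfa_op M \<sigma> *\<^sub>v \<psi>))"
    unfolding set_pmf_iff pmf_kind by auto
qed

text \<open>The condition on \<open>v\<close> lets the sum range over all kinds, while the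
  nonhalting outcome contributes only through the recursive term.\<close>

lemma round_value_qfa_step:
  assumes "v Nonhalting = 0"
  shows "round_value (qfa_step M) v (\<sigma> # u) \<psi> =
    norm_sq (kind_proj M Nonhalting (qfa_op M \<sigma> *\<^sub>v \<psi>)) *
      round_value (qfa_step M) v u (normalize_vec (kind_proj M Nonhalting (qfa_op M \<sigma> *\<^sub>v \<psi>))) +
    (\<Sum>k\<in>UNIV. norm_sq (kind_proj M k (qfa_op M \<sigma> *\<^sub>v \<psi>)) * v k)"
proof -
  have "round_value (qfa_step M) v (\<sigma> # u) \<psi> =
     (\<Sum>k\<in>UNIV. (if k = Nonhalting then round_value (qfa_step M) v u (normalize_vec (kind_proj M k (qfa_op M \<sigma> *\<^sub>v \<psi>)))
       else v k) * norm_sq (kind_proj M k (qfa_op M \<sigma> *\<^sub>v \<psi>)))"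
    unfolding round_value.simps qfa_step_def integral_map_pmf
    by (subst integral_measure_pmf_real[where A = UNIV]) (auto simp: pmf_kind)
  then show ?thesis using assms by (simp add: UNIV_kind mult.commute)
qed

end

text \<open>Entry \<open>j\<close> of the row vector \<open>r\<close> multiplied from the right by
  the matrices of the symbols before the end-marker, the last symbol first. Up to scaling it is the
  amplitude with which basis state \<open>j\<close> ends the round in the outcome described by
  \<open>r\<close>.\<close>

primrec amp :: "nat \<Rightarrow> ('a tape_symbol \<Rightarrow> nat \<Rightarrow> nat \<Rightarrow> real) \<Rightarrow> (nat \<Rightarrow> real) \<Rightarrow> 'a tape_symbol list \<Rightarrow> nat \<Rightarrow> real"
  where
  "amp m B r [] j = 0"
| "amp m B r (\<sigma> # u) j = (if \<sigma> = Right_End then r j else (\<Sum>i<m. amp m B r u i * B \<sigma> i j))"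

text \<open>States below \<open>m\<close> hold the computation, \<open>2 * m\<close> accepts,
  \<open>2 * m + 1\<close> rejects, and the states between collect the lost amplitude and restart.
  Halting happens only on the right end-marker. Only columns below \<open>m\<close> are prescribed,
  since the state vector is always supported there.\<close>

locale amplitude_machine =
  fixes m q0 :: nat and B :: "'a tape_symbol \<Rightarrow> nat \<Rightarrow> nat \<Rightarrow> real" and r :: "kind \<Rightarrow> nat \<Rightarrow> real"
    and M :: "'a qfa"
  assumes q0: "q0 < m"
    and size: "qfa_size M = 2 * m + 2"
    and init: "qfa_init M = q0"
    and kinds: "\<And>i. qfa_kind M i = (if i < m then Nonhalting else if i = 2 * m then Accepting
      else if i = 2 * m + 1 then Rejecting else Restarting)"
    and unitary: "\<And>\<sigma>. unitary (2 * m + 2) (qfa_op M \<sigma>)"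
    and op: "\<And>\<sigma> i j. \<sigma> \<noteq> Right_End \<Longrightarrow> i < m \<Longrightarrow> j < m \<Longrightarrow> qfa_op M \<sigma> $$ (i, j) = complex_of_real (B \<sigma> i j / (4 * m))"
      "\<And>\<sigma> j. \<sigma> \<noteq> Right_End \<Longrightarrow> j < m \<Longrightarrow> qfa_op M \<sigma> $$ (2 * m, j) = 0"
      "\<And>\<sigma> j. \<sigma> \<noteq> Right_End \<Longrightarrow> j < m \<Longrightarrow> qfa_op M \<sigma> $$ (2 * m + 1, j) = 0"
    and op_end: "\<And>i j. i < m \<Longrightarrow> j < m \<Longrightarrow> qfa_op M Right_End $$ (i, j) = 0"
      "\<And>j. j < m \<Longrightarrow> qfa_op M Right_End $$ (2 * m, j) = complex_of_real (r Accepting j / (4 * m))"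
      "\<And>j. j < m \<Longrightarrow> qfa_op M Right_End $$ (2 * m + 1, j) = complex_of_real (r Rejecting j / (4 * m))"
begin

text \<open>The invariant of the memory of a running machine: a unit vector supported on the
  nonhalting basis states.\<close>

definition good :: "complex vec \<Rightarrow> bool" where
  "good \<psi> \<longleftrightarrow> \<psi> \<in> carrier_vec (2 * m + 2) \<and> norm_sq \<psi> = 1 \<and> (\<forall>i. m \<le> i \<and> i < 2 * m + 2 \<longrightarrow> \<psi> $ i = 0)"

definition idx :: "kind \<Rightarrow> nat" where
  "idx k = (if k = Accepting then 2 * m else 2 * m + 1)"

lemma m_pos: "m > 0" using q0 by simp

lemma op_mult:
  assumes "good \<psi>" "i < 2 * m + 2"
  shows "(qfa_op M \<sigma> *\<^sub>v \<psi>) $ i = (\<Sum>j<m. qfa_op M \<sigma> $$ (i, j) * \<psi> $ j)"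
proof -
  have "(qfa_op M \<sigma> *\<^sub>v \<psi>) $ i = (\<Sum>j<2 * m + 2. qfa_op M \<sigma> $$ (i, j) * \<psi> $ j)"
    using assms unitary[of \<sigma>]
    by (auto simp: scalar_prod_def good_def unitary_def atLeast0LessThan intro!: sum.cong)
  also have "\<dots> = (\<Sum>j<m. qfa_op M \<sigma> $$ (i, j) * \<psi> $ j)"
    using assms by (intro sum.mono_neutral_right) (auto simp: good_def)
  finally show ?thesis .
qed

lemma norm_sq_halting:
  assumes "k \<in> {Accepting, Rejecting}"
  shows "norm_sq (kind_proj M k v) = (cmod (v $ idx k))\<^sup>2"
proof -
  have idx: "qfa_kind M i = k \<longleftrightarrow> i = idx k" for i
    using assms m_pos by (cases k) (simp_all add: kinds idx_def)
  have "norm_sq (kind_proj M k v) = (\<Sum>i<2 * m + 2. if i = idx k then (cmod (v $ i))\<^sup>2 else 0)"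
    unfolding norm_sq_kind_proj size idx ..
  also have "\<dots> = (if idx k \<in> {..<2 * m + 2} then (cmod (v $ idx k))\<^sup>2 else 0)"
    by (rule sum.delta) simp
  also have "\<dots> = (cmod (v $ idx k))\<^sup>2" by (simp add: idx_def)
  finally show ?thesis .
qed

lemma norm_sq_nonhalting: "norm_sq (kind_proj M Nonhalting v) = (\<Sum>i<m. (cmod (v $ i))\<^sup>2)"
proof -
  have "norm_sq (kind_proj M Nonhalting v) = (\<Sum>i<2 * m + 2. if i < m then (cmod (v $ i))\<^sup>2 else 0)"
    unfolding norm_sq_kind_proj size by (intro sum.cong) (auto simp: kinds)
  also have "\<dots> = (\<Sum>i<m. (cmod (v $ i))\<^sup>2)"
    by (rule sum.mono_neutral_cong_right) auto
  finally show ?thesis .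
qed

lemma good_start: "good (qfa_start M)"
proof -
  have "norm_sq (qfa_start M) = (\<Sum>i<2 * m + 2. if i = q0 then 1 else 0)"
    unfolding norm_sq_def qfa_start_def size init by (rule sum.cong) (auto simp: unit_vec_def)
  also have "\<dots> = 1" using q0 by simp
  finally show ?thesis using q0 by (auto simp: good_def qfa_start_def size init)
qed

lemma good_normalize_kind_proj:
  assumes "norm_sq (kind_proj M Nonhalting v) \<noteq> 0"
  shows "good (normalize_vec (kind_proj M Nonhalting v))"
  unfolding good_def
proof (intro conjI allI impI)
  let ?v = "kind_proj M Nonhalting v"
  have dim: "dim_vec ?v = 2 * m + 2" by (simp add: kind_proj_def size)
  then show "normalize_vec ?v \<in> carrier_vec (2 * m + 2)"
    by (intro carrier_vecI) (simp only: dim_normalize)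
  show "norm_sq (normalize_vec ?v) = 1" by (rule norm_sq_normalize[OF assms])
  show "normalize_vec ?v $ i = 0" if "m \<le> i \<and> i < 2 * m + 2" for i
  proof -
    have "qfa_kind M i \<noteq> Nonhalting" using that by (simp add: kinds)
    then have "?v $ i = 0" using that unfolding kind_proj_def size by (subst index_vec) simp_all
    then show ?thesis using that dim by (subst normalize_index) simp_all
  qed
qed

lemma good_carrier: "good \<psi> \<Longrightarrow> \<psi> \<in> carrier_vec (qfa_size M)" "good \<psi> \<Longrightarrow> norm_sq \<psi> = 1"
  by (simp_all add: good_def size)

lemma unitary': "Defs.unitary (qfa_size M) (qfa_op M \<sigma>)"
  using unitary[of \<sigma>] by (simp only: size)

lemma no_nonhalting_at_end:
  assumes "good \<psi>"
  shows "norm_sq (kind_proj M Nonhalting (qfa_op M Right_End *\<^sub>v \<psi>)) = 0"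
  unfolding norm_sq_nonhalting using op_mult[OF assms] op_end(1) by simp

text \<open>On the right end-marker the nonhalting outcome has probability 0 and is outside the
  support, so the head cannot pass the tape; elsewhere a nonhalting outcome has nonzero norm and can
  be normalized.\<close>

lemma run_invariant:
  "Running i \<psi> \<in> set_pmf (run (qfa_start M) (qfa_step M) w t) \<Longrightarrow> i < length (tape w) \<and> good \<psi>"
proof (induction t arbitrary: i \<psi>)
  case 0
  then show ?case by (simp add: good_start tape_def)
next
  case (Suc t)
  then obtain s where s: "s \<in> set_pmf (run (qfa_start M) (qfa_step M) w t)"
    and step: "Running i \<psi> \<in> set_pmf (config_step (qfa_start M) (qfa_step M) w s)" by auto
  show ?case
  proof (cases s)
    case (Running j \<phi>)
    then have j: "j < length (tape w)" and g: "good \<phi>" using Suc.IH s by auto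
    from step Running j obtain k \<phi>' where k: "(k, \<phi>') \<in> set_pmf (qfa_step M (tape w ! j) \<phi>)"
      "successor (qfa_start M) j (k, \<phi>') = Running i \<psi>" by auto
    note k' = set_qfa_step[OF unitary' good_carrier[OF g] k(1)]
    show ?thesis
    proof (cases k)
      case Nonhalting
      then have "tape w ! j \<noteq> Right_End" using k'(1) no_nonhalting_at_end[OF g] by metis
      moreover have "tape w ! (length (tape w) - 1) = Right_End"
        by (simp add: tape_def nth_append)
      ultimately have "j \<noteq> length (tape w) - 1" by metis
      then have "Suc j < length (tape w)" using j by linarith
      moreover have "i = Suc j" "\<psi> = \<phi>'" using k(2) Nonhalting by simp_all
      moreover have "good \<phi>'"
        unfolding k'(2) Nonhalting using k'(1) Nonhalting by (intro good_normalize_kind_proj) simp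
      ultimately show ?thesis by simp
    next
      case Restarting
      then have "i = 0" "\<psi> = qfa_start M" using k(2) by simp_all
      then show ?thesis using good_start by (simp add: tape_def)
    next
      case Accepting
      then show ?thesis using k(2) by simp
    next
      case Rejecting
      then show ?thesis using k(2) by simp
    qed
  qed (use step in simp_all)
qed

lemma is_qfa_restart: "is_qfa_restart M"
  using run_invariant q0 unitary' by (auto simp: is_qfa_restart_def rounds_end_def size init kinds)

text \<open>The probability \<open>?p\<close> of continuing cancels the normalization of the
  collapsed vector, so the round behaves as if unnormalized vectors were multiplied by the matrices.
  Each symbol, the end-marker included, contributes one factor \<open>1 / (4 * m)\<close> to the
  amplitude.\<close>

lemma round_prob_eq:
  assumes k: "k \<in> {Accepting, Rejecting}" and "Right_End \<notin> set u" "good \<psi>"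
  shows "round_prob (qfa_step M) k (u @ [Right_End]) \<psi> =
    (cmod (\<Sum>j<m. complex_of_real (amp m B (r k) (u @ [Right_End]) j) * \<psi> $ j))\<^sup>2 / (4 * real m) ^ (2 * Suc (length u))"
  using assms(2,3)
proof (induction u arbitrary: \<psi>)
  case Nil
  let ?\<phi> = "qfa_op M Right_End *\<^sub>v \<psi>"
  have "?\<phi> $ idx k = (\<Sum>j<m. complex_of_real (r k j) * \<psi> $ j) / (4 * m)"
    using k op_end op_mult[OF Nil(2), of "idx k" Right_End] by (auto simp: idx_def sum_divide_distrib)
  moreover have "round_prob (qfa_step M) k [Right_End] \<psi> = norm_sq (kind_proj M k ?\<phi>)"
    using k by (auto simp: round_prob_def UNIV_kind simp del: round_value.simps(2)
        simp: round_value_qfa_step[OF unitary' good_carrier[OF Nil(2)]])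
  ultimately show ?case
    by (simp add: norm_sq_halting[OF k] norm_divide power_divide norm_mult power2_eq_square)
next
  case (Cons \<sigma> u)
  let ?a = "amp m B (r k) (u @ [Right_End])"
  let ?\<phi> = "qfa_op M \<sigma> *\<^sub>v \<psi>" and ?l = "4 * real m"
  let ?\<psi> = "normalize_vec (kind_proj M Nonhalting ?\<phi>)" and ?p = "norm_sq (kind_proj M Nonhalting ?\<phi>)"
  have \<sigma>: "\<sigma> \<noteq> Right_End" using Cons by auto
  have l: "?l > 0" using m_pos by simp
  have \<phi>: "?\<phi> $ i = (\<Sum>j<m. complex_of_real (B \<sigma> i j) * \<psi> $ j) / complex_of_real ?l" if "i < m" for i
    using op(1)[OF \<sigma> that] op_mult[OF Cons(3), of i \<sigma>] that by (simp add: sum_divide_distrib)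
  have \<phi>0: "?\<phi> $ idx k = 0"
    using op(2,3)[OF \<sigma>] op_mult[OF Cons(3), of "idx k" \<sigma>] by (auto simp: idx_def)
  have sum: "(\<Sum>j<m. complex_of_real (amp m B (r k) ((\<sigma> # u) @ [Right_End]) j) * \<psi> $ j) =
      complex_of_real ?l * (\<Sum>i<m. complex_of_real (?a i) * ?\<phi> $ i)"
  proof -
    have "(\<Sum>j<m. complex_of_real (amp m B (r k) ((\<sigma> # u) @ [Right_End]) j) * \<psi> $ j) =
      (\<Sum>j<m. \<Sum>i<m. complex_of_real (?a i) * (complex_of_real (B \<sigma> i j) * \<psi> $ j))"
      using \<sigma> by (simp add: sum_distrib_right mult.assoc)
    also have "\<dots> = (\<Sum>i<m. complex_of_real (?a i) * (\<Sum>j<m. complex_of_real (B \<sigma> i j) * \<psi> $ j))"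
      by (subst sum.swap) (simp add: sum_distrib_left)
    also have "\<dots> = (\<Sum>i<m. complex_of_real ?l * (complex_of_real (?a i) * ?\<phi> $ i))"
      using l \<phi> by (intro sum.cong) auto
    finally show ?thesis by (simp only: sum_distrib_left)
  qed
  have "round_prob (qfa_step M) k ((\<sigma> # u) @ [Right_End]) \<psi> =
      ?p * round_prob (qfa_step M) k (u @ [Right_End]) ?\<psi> + norm_sq (kind_proj M k ?\<phi>)"
    using k by (auto simp: round_prob_def UNIV_kind simp del: round_value.simps(2)
        simp: round_value_qfa_step[OF unitary' good_carrier[OF Cons(3)]])
  also have "norm_sq (kind_proj M k ?\<phi>) = 0" using \<phi>0 by (simp add: norm_sq_halting[OF k])
  also have "?p * round_prob (qfa_step M) k (u @ [Right_End]) ?\<psi> =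
      (cmod (\<Sum>i<m. complex_of_real (?a i) * ?\<phi> $ i))\<^sup>2 / ?l ^ (2 * Suc (length u))"
  proof (cases "?p = 0")
    \<comment> \<open>The collapsed vector has no meaning here, but its weight is 0 and the
      amplitudes on the right vanish as well.\<close>
    case True
    then have "\<forall>i<m. ?\<phi> $ i = 0" unfolding norm_sq_nonhalting by (simp add: sum_nonneg_eq_0_iff)
    then show ?thesis using True by simp
  next
    case False
    have ix: "?\<psi> $ i = ?\<phi> $ i / complex_of_real (sqrt ?p)" if "i < m" for i
      using that by (subst normalize_index) (auto simp: kind_proj_def size kinds)
    have "(\<Sum>i<m. complex_of_real (?a i) * ?\<psi> $ i) =
        (\<Sum>i<m. complex_of_real (?a i) * ?\<phi> $ i) / complex_of_real (sqrt ?p)"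
      by (simp add: ix sum_divide_distrib)
    then have "(cmod (\<Sum>i<m. complex_of_real (?a i) * ?\<psi> $ i))\<^sup>2 =
        (cmod (\<Sum>i<m. complex_of_real (?a i) * ?\<phi> $ i))\<^sup>2 / ?p"
      by (simp add: norm_divide power_divide norm_sq_nonneg)
    then show ?thesis
      using Cons.IH[OF _ good_normalize_kind_proj[OF False]] Cons.prems False by simp
  qed
  finally have rp: "round_prob (qfa_step M) k ((\<sigma> # u) @ [Right_End]) \<psi> =
      (cmod (\<Sum>i<m. complex_of_real (?a i) * ?\<phi> $ i))\<^sup>2 / ?l ^ (2 * Suc (length u))"
    unfolding add_0_right .
  have scale: "(cmod (complex_of_real ?l * S))\<^sup>2 / ?l ^ (2 * Suc (length (\<sigma> # u))) =
      (cmod S)\<^sup>2 / ?l ^ (2 * Suc (length u))" for S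
  proof -
    have 1: "(cmod (complex_of_real ?l * S))\<^sup>2 = ?l\<^sup>2 * (cmod S)\<^sup>2"
      by (simp only: norm_mult norm_of_real power_mult_distrib power2_abs)
    have 2: "?l ^ (2 * Suc (length (\<sigma> # u))) = ?l\<^sup>2 * ?l ^ (2 * Suc (length u))"
      by (simp only: power_add[symmetric]) simp
    have "c * a / (c * b) = a / b" if "c \<noteq> 0" for a b c :: real using that by simp
    moreover have "?l\<^sup>2 \<noteq> 0" using l by simp
    ultimately show ?thesis unfolding 1 2 by blast
  qed
  have "?case \<longleftrightarrow> round_prob (qfa_step M) k ((\<sigma> # u) @ [Right_End]) \<psi> =
      (cmod (complex_of_real ?l * (\<Sum>i<m. complex_of_real (?a i) * ?\<phi> $ i)))\<^sup>2 / ?l ^ (2 * Suc (length (\<sigma> # u)))"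
    by (subst sum) (rule refl)
  then show ?case using trans[OF rp scale[symmetric]] by blast
qed

lemma round_prob_start:
  assumes k: "k \<in> {Accepting, Rejecting}"
  shows "round_prob (qfa_step M) k (tape w) (qfa_start M) =
    (amp m B (r k) (tape w) q0)\<^sup>2 / (4 * real m) ^ (2 * length (tape w))"
proof -
  have t: "tape w = (Left_End # map Letter w) @ [Right_End]" by (simp add: tape_def)
  have "(\<Sum>j<m. complex_of_real (amp m B (r k) (tape w) j) * qfa_start M $ j) =
      (\<Sum>j<m. if j = q0 then complex_of_real (amp m B (r k) (tape w) j) else 0)"
    using q0 by (intro sum.cong) (auto simp: qfa_start_def size init unit_vec_def)
  also have "\<dots> = complex_of_real (amp m B (r k) (tape w) q0)"
    using q0 by (subst sum.delta) simp_all
  finally have sum: "(\<Sum>j<m. complex_of_real (amp m B (r k) (tape w) j) * qfa_start M $ j) =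
      complex_of_real (amp m B (r k) (tape w) q0)" .
  have len: "Suc (length (Left_End # map Letter w)) = length (tape w)" by (simp add: tape_def)
  have "Right_End \<notin> set (Left_End # map Letter w)" by auto
  from round_prob_eq[OF k this good_start] show ?thesis
    unfolding len t[symmetric] sum norm_of_real power2_abs .
qed

sublocale restart_run "qfa_start M" "qfa_step M" w for w
  using run_invariant by unfold_locales auto

end

text \<open>After division by \<open>4 * m\<close> the prescribed part of a column has inner
  products of size at most \<open>m / (16 * m * m)\<close>, or \<open>2 / (16 * m * m)\<close> on
  the end-marker. Both are at most \<open>1 / (4 * m)\<close>, as the unitary completion
  requires.\<close>

lemma exists_amplitude_machine:
  fixes B :: "'a tape_symbol \<Rightarrow> nat \<Rightarrow> nat \<Rightarrow> real"
  assumes q0: "q0 < m"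
    and B: "\<And>\<sigma> i j. i < m \<Longrightarrow> j < m \<Longrightarrow> \<bar>B \<sigma> i j\<bar> \<le> 1"
    and r: "\<And>k j. j < m \<Longrightarrow> \<bar>r k j\<bar> \<le> 1"
  shows "\<exists>M. amplitude_machine m q0 B r M"
proof -
  define x where "x \<sigma> i j = (if \<sigma> = Right_End
      then (if i < m then 0 else if i = 2 * m then r Accepting j else r Rejecting j)
      else (if i < m then B \<sigma> i j else 0)) / (4 * real m)" for \<sigma> i j
  have m: "real m \<ge> 1" using q0 by simp
  have prod: "\<bar>a / (4 * real m) * (b / (4 * real m))\<bar> \<le> 1 / (16 * (real m * real m))"
    if "\<bar>a\<bar> \<le> 1" "\<bar>b\<bar> \<le> 1" for a b
  proof -
    have "\<bar>a\<bar> * \<bar>b\<bar> \<le> 1 * 1" using that by (intro mult_mono) auto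
    then show ?thesis using m by (simp add: abs_mult divide_simps)
  qed
  have m1: "1 / (16 * (real m * real m)) + 1 / (16 * (real m * real m)) \<le> 1 / (4 * real m)"
    using m by (simp add: field_simps)
  have bound: "\<bar>(\<Sum>i<m. x \<sigma> i j * x \<sigma> i k) + x \<sigma> (2 * m) j * x \<sigma> (2 * m) k
      + x \<sigma> (2 * m + 1) j * x \<sigma> (2 * m + 1) k\<bar> \<le> 1 / (4 * real m)" if "j < m" "k < m" for \<sigma> j k
  proof (cases "\<sigma> = Right_End")
    case True
    then have "\<bar>x \<sigma> (2 * m) j * x \<sigma> (2 * m) k + x \<sigma> (2 * m + 1) j * x \<sigma> (2 * m + 1) k\<bar> \<le> 1 / (4 * real m)"
      using prod[OF r r, OF that, of Accepting Accepting] prod[OF r r, OF that, of Rejecting Rejecting] m1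
      by (auto simp: x_def intro: order_trans[OF abs_triangle_ineq])
    then show ?thesis using True by (simp add: x_def)
  next
    case False
    have "\<bar>\<Sum>i<m. x \<sigma> i j * x \<sigma> i k\<bar> \<le> (\<Sum>i<m. \<bar>x \<sigma> i j * x \<sigma> i k\<bar>)" by (rule sum_abs)
    also have "\<dots> \<le> (\<Sum>i<m. 1 / (16 * (real m * real m)))"
      using prod[OF B B] that False by (intro sum_mono) (auto simp: x_def)
    also have "\<dots> \<le> 1 / (4 * real m)" using m by (simp add: field_simps)
    finally show ?thesis using False by (simp add: x_def)
  qed
  have "\<exists>U. unitary (2 * m + 2) U \<and>
    (\<forall>i j. j < m \<and> i < 2 * m + 2 \<and> (i < m \<or> 2 * m \<le> i) \<longrightarrow> U $$ (i, j) = complex_of_real (x \<sigma> i j))" for \<sigma>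
    by (rule exists_unitary_with_block[OF bound])
  then obtain U where U: "\<And>\<sigma>. unitary (2 * m + 2) (U \<sigma>)"
    "\<And>\<sigma> i j. j < m \<Longrightarrow> i < 2 * m + 2 \<Longrightarrow> i < m \<or> 2 * m \<le> i \<Longrightarrow> U \<sigma> $$ (i, j) = complex_of_real (x \<sigma> i j)"
    by metis
  define M where "M = \<lparr>qfa_size = 2 * m + 2,
    qfa_kind = (\<lambda>i. if i < m then Nonhalting else if i = 2 * m then Accepting
      else if i = 2 * m + 1 then Rejecting else Restarting),
    qfa_init = q0, qfa_op = U\<rparr>"
  have "amplitude_machine m q0 B r M"
    using q0 U by unfold_locales (auto simp: M_def x_def)
  then show ?thesis ..
qed

section \<open>Simulation of probabilistic automata\<close>

definition kind_mass :: "'a pfa \<Rightarrow> 'a tape_symbol \<Rightarrow> kind \<Rightarrow> nat \<Rightarrow> real" where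
  "kind_mass P \<sigma> k q = (\<Sum>q'<pfa_size P. of_bool (pfa_kind P q' = k) * pfa_trans P \<sigma> $$ (q', q))"

context
  fixes P :: "'a pfa"
  assumes P: "is_pfa_restart P"
begin

lemma trans_nonneg: "q < pfa_size P \<Longrightarrow> q' < pfa_size P \<Longrightarrow> 0 \<le> pfa_trans P \<sigma> $$ (q', q)"
  and trans_sum: "q < pfa_size P \<Longrightarrow> (\<Sum>q'<pfa_size P. pfa_trans P \<sigma> $$ (q', q)) = 1"
  using P by (auto simp: is_pfa_restart_def stochastic_def)

lemma trans_le_1:
  assumes "q < pfa_size P" "q' < pfa_size P"
  shows "pfa_trans P \<sigma> $$ (q', q) \<le> 1"
proof -
  have "pfa_trans P \<sigma> $$ (q', q) \<le> (\<Sum>q'<pfa_size P. pfa_trans P \<sigma> $$ (q', q))"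
    using assms by (intro member_le_sum) (auto intro: trans_nonneg)
  then show ?thesis using trans_sum[OF assms(1)] by simp
qed

lemma kind_mass_nonneg: "q < pfa_size P \<Longrightarrow> 0 \<le> kind_mass P \<sigma> k q"
  unfolding kind_mass_def by (intro sum_nonneg mult_nonneg_nonneg trans_nonneg) auto

lemma kind_mass_le_1:
  assumes "q < pfa_size P"
  shows "kind_mass P \<sigma> k q \<le> 1"
proof -
  have "kind_mass P \<sigma> k q \<le> (\<Sum>q'<pfa_size P. 1 * pfa_trans P \<sigma> $$ (q', q))"
    unfolding kind_mass_def using assms by (intro sum_mono mult_right_mono trans_nonneg) auto
  then show ?thesis using trans_sum[OF assms] by simp
qed

lemma round_value_pfa_step:
  assumes q: "q < pfa_size P"
  shows "round_value (pfa_step P) v (\<sigma> # u) q = (\<Sum>q'<pfa_size P. pfa_trans P \<sigma> $$ (q', q) *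
    (if pfa_kind P q' = Nonhalting then round_value (pfa_step P) v u q' else v (pfa_kind P q')))"
proof -
  let ?n = "pfa_size P" and ?f = "\<lambda>q'. if q' < pfa_size P then pfa_trans P \<sigma> $$ (q', q) else 0"
  have "(\<integral>\<^sup>+q'. ennreal (?f q') \<partial>count_space UNIV) = (\<integral>\<^sup>+q'. ennreal (?f q') \<partial>count_space {..<?n})"
    by (rule nn_integral_count_space_eq) auto
  also have "\<dots> = (\<Sum>q'<?n. ennreal (pfa_trans P \<sigma> $$ (q', q)))"
    by (simp add: nn_integral_count_space_finite)
  also have "\<dots> = 1" using q by (subst sum_ennreal) (auto simp: trans_nonneg trans_sum)
  finally have prob: "(\<integral>\<^sup>+q'. ennreal (?f q') \<partial>count_space UNIV) = 1" .
  have pmf: "pmf (embed_pmf ?f) q' = ?f q'" for q'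
    using q by (intro pmf_embed_pmf prob) (simp add: trans_nonneg)
  show ?thesis
    unfolding round_value.simps pfa_step_def integral_map_pmf
    by (subst integral_measure_pmf_real[where A = "{..<?n}"])
      (auto simp: pmf set_pmf_eq mult.commute split: if_splits intro!: sum.cong)
qed

lemma round_prob_pfa_step:
  assumes q: "q < pfa_size P" and k: "k \<noteq> Nonhalting"
  shows "round_prob (pfa_step P) k (\<sigma> # u) q = kind_mass P \<sigma> k q + (\<Sum>q'<pfa_size P.
    of_bool (pfa_kind P q' = Nonhalting) * (round_prob (pfa_step P) k u q' * pfa_trans P \<sigma> $$ (q', q)))"
  unfolding round_prob_def round_value_pfa_step[OF q] kind_mass_def sum.distrib[symmetric]
  using k by (intro sum.cong) auto

lemma pfa_restart_run: "restart_run (pfa_init P) (pfa_step P) w"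
  using P unfolding is_pfa_restart_def rounds_end_def by unfold_locales blast

text \<open>Guarantees, by contraposition, a state that is not nonhalting, whose coordinate can be
  reused as an accumulator.\<close>

lemma no_halting_state_imp_zero:
  assumes "\<And>q. q < pfa_size P \<Longrightarrow> pfa_kind P q = Nonhalting" and k: "k \<noteq> Nonhalting"
  shows "q < pfa_size P \<Longrightarrow> round_prob (pfa_step P) k u q = 0"
proof (induction u arbitrary: q)
  case Nil
  then show ?case by (simp add: round_prob_def)
next
  case (Cons \<sigma> u)
  have "kind_mass P \<sigma> k q = 0"
    using assms k unfolding kind_mass_def by (intro sum.neutral) auto
  then show ?case using Cons by (simp add: round_prob_pfa_step[OF Cons.prems k])
qed

text \<open>Coordinate \<open>h\<close>, whose state is halting and thus never occupied, accumulates the probability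
  of having accepted in the current round, and coordinate \<open>pfa_size P\<close> that of having rejected.\<close>

definition memory :: "nat \<Rightarrow> kind \<Rightarrow> nat" where
  "memory h k = (if k = Accepting then h else pfa_size P)"

text \<open>The identity columns carry accumulated mass unchanged to the end of the tape. Mass that
  enters a restarting state is dropped, so columns may sum to less than 1.\<close>

definition round_matrix :: "nat \<Rightarrow> 'a tape_symbol \<Rightarrow> nat \<Rightarrow> nat \<Rightarrow> real" where
  "round_matrix h \<sigma> i j =
     (if j = pfa_size P \<or> j = h then of_bool (i = j)
      else if i = pfa_size P then kind_mass P \<sigma> Rejecting j
      else if i = h then kind_mass P \<sigma> Accepting j
      else of_bool (pfa_kind P i = Nonhalting) * pfa_trans P \<sigma> $$ (i, j))"

text \<open>The end-marker delivers the stored mass together with the mass that halts on that very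
  symbol.\<close>

definition round_output :: "nat \<Rightarrow> kind \<Rightarrow> nat \<Rightarrow> real" where
  "round_output h k j = (if j = pfa_size P \<or> j = h then of_bool (j = memory h k) else kind_mass P Right_End k j)"

lemma abs_round_matrix_le:
  assumes "i < Suc (pfa_size P)" "j < Suc (pfa_size P)"
  shows "\<bar>round_matrix h \<sigma> i j\<bar> \<le> 1"
  using assms kind_mass_nonneg[of j] kind_mass_le_1[of j] trans_nonneg[of j i] trans_le_1[of j i]
  by (auto simp: round_matrix_def less_Suc_eq)

lemma abs_round_output_le:
  assumes "j < Suc (pfa_size P)"
  shows "\<bar>round_output h k j\<bar> \<le> 1"
  using assms kind_mass_nonneg[of j] kind_mass_le_1[of j] by (auto simp: round_output_def less_Suc_eq)

text \<open>Both sides obey the same backward recursion over the tape. Seen backwards, an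
  accumulator is a round that has already ended, worth 1 for its own kind and 0 for the
  other.\<close>

lemma amp_eq_round_prob:
  assumes k: "k \<in> {Accepting, Rejecting}" and h: "h < pfa_size P" "pfa_kind P h \<noteq> Nonhalting"
    and "Right_End \<notin> set u"
  defines "a \<equiv> \<lambda>u. amp (Suc (pfa_size P)) (round_matrix h) (round_output h k) (u @ [Right_End])"
  shows "(\<forall>q<pfa_size P. q \<noteq> h \<longrightarrow> a u q = round_prob (pfa_step P) k (u @ [Right_End]) q) \<and>
    (\<forall>q\<in>{h, pfa_size P}. a u q = of_bool (q = memory h k))"
  using assms(4)
proof (induction u)
  case Nil
  have "k \<noteq> Nonhalting" using k by auto
  then show ?case
    using h by (auto simp: a_def round_output_def round_prob_pfa_step)
next
  case (Cons \<sigma> u)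
  let ?n = "pfa_size P" and ?rp = "round_prob (pfa_step P) k (u @ [Right_End])"
  have \<sigma>: "\<sigma> \<noteq> Right_End" using Cons by auto
  have kn: "k \<noteq> Nonhalting" using k by auto
  have IH1: "a u q = ?rp q" if "q < ?n" "q \<noteq> h" for q
    using Cons.IH Cons.prems that by simp
  have IH2: "a u q = of_bool (q = memory h k)" if "q \<in> {h, ?n}" for q
    using Cons.IH Cons.prems that by (metis list.set_intros(2))
  have a_Cons: "a (\<sigma> # u) q = (\<Sum>i<Suc ?n. a u i * round_matrix h \<sigma> i q)" for q
    using \<sigma> by (simp add: a_def)
  have "a (\<sigma> # u) q = round_prob (pfa_step P) k ((\<sigma> # u) @ [Right_End]) q" if q: "q < ?n" "q \<noteq> h" for q
  proof -
    have "a (\<sigma> # u) q = (\<Sum>i<?n. a u i * round_matrix h \<sigma> i q) + a u ?n * kind_mass P \<sigma> Rejecting q"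
      using q by (simp add: a_Cons round_matrix_def)
    \<comment> \<open>The summand \<open>i = h\<close> is split off: it carries the accepting mass,
      and the probabilistic recursion has no continuation from the state \<open>h\<close>.\<close>
    also have "(\<Sum>i<?n. a u i * round_matrix h \<sigma> i q) =
      (\<Sum>i<?n. (if i = h then of_bool (k = Accepting) * kind_mass P \<sigma> Accepting q else 0) +
        of_bool (pfa_kind P i = Nonhalting) * (?rp i * pfa_trans P \<sigma> $$ (i, q)))"
    proof (rule sum.cong[OF refl])
      fix i assume "i \<in> {..<?n}"
      then show "a u i * round_matrix h \<sigma> i q =
        (if i = h then of_bool (k = Accepting) * kind_mass P \<sigma> Accepting q else 0) +
        of_bool (pfa_kind P i = Nonhalting) * (?rp i * pfa_trans P \<sigma> $$ (i, q))"
        using q h IH1[of i] IH2[of h] by (cases "i = h") (auto simp: round_matrix_def memory_def)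
    qed
    also have "\<dots> = of_bool (k = Accepting) * kind_mass P \<sigma> Accepting q + (\<Sum>i<?n.
        of_bool (pfa_kind P i = Nonhalting) * (?rp i * pfa_trans P \<sigma> $$ (i, q)))"
      unfolding sum.distrib using h(1) by (subst sum.delta) auto
    finally show ?thesis
      using k kn q h IH2[of ?n] by (auto simp: round_prob_pfa_step memory_def)
  qed
  moreover have "a (\<sigma> # u) q = of_bool (q = memory h k)" if "q \<in> {h, ?n}" for q
  proof -
    have "a (\<sigma> # u) q = (\<Sum>i<Suc ?n. if i = q then a u q else 0)"
      unfolding a_Cons using that by (intro sum.cong) (auto simp: round_matrix_def)
    also have "\<dots> = a u q" using that h by (subst sum.delta) auto
    finally show ?thesis using IH2[OF that] by simp
  qed
  ultimately show ?case by blast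
qed

end

text \<open>An error below 1/2 forces \<open>b \<le> a\<close>, and then squaring favours the larger
  weight: after clearing denominators the claim is \<open>a * b * b \<le> a * a * b\<close>.\<close>

lemma square_ratio_ge:
  fixes a b \<epsilon> :: real
  assumes "a \<ge> 0" "b \<ge> 0" "a + b > 0" "\<epsilon> < 1 / 2" "a / (a + b) \<ge> 1 - \<epsilon>"
  shows "a\<^sup>2 / (a\<^sup>2 + b\<^sup>2) \<ge> 1 - \<epsilon>"
proof -
  have "a / (a + b) > 1 / 2" using assms by linarith
  then have ab: "b \<le> a" "a > 0" using assms by (auto simp: field_simps)
  have "a / (a + b) \<le> a\<^sup>2 / (a\<^sup>2 + b\<^sup>2)"
  proof -
    have "a * (a\<^sup>2 + b\<^sup>2) \<le> a\<^sup>2 * (a + b)"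
      using ab assms mult_left_mono[OF ab(1), of "a * b"] by (simp add: power2_eq_square algebra_simps)
    moreover have "a\<^sup>2 + b\<^sup>2 > 0" using ab by (simp add: add_pos_nonneg)
    ultimately show ?thesis using assms(3) by (simp add: divide_simps)
  qed
  with assms show ?thesis by linarith
qed

lemma time_bigo_transfer:
  fixes T T' :: "'a list \<Rightarrow> ennreal" and l C :: real
  assumes "C > 0" "l \<ge> 0"
    and le: "\<And>w. T w < \<infinity> \<Longrightarrow> T' w \<le> ennreal (C * l ^ (2 * length w) * (enn2real (T w))\<^sup>2)"
    and T: "time_bigo T s"
  shows "time_bigo T' (\<lambda>m. l ^ (2 * m) * (s m)\<^sup>2)"
proof -
  have fin: "\<forall>\<^sub>F w in filtercomap length at_top. T w < \<infinity>"
    and O: "(\<lambda>w. enn2real (T w)) \<in> O[filtercomap length at_top](\<lambda>w. s (length w))"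
    using T by (auto simp: time_bigo_def)
  from O obtain c where c: "c > 0"
    "\<forall>\<^sub>F w in filtercomap length at_top. norm (enn2real (T w)) \<le> c * norm (s (length w))"
    by (auto elim: landau_o.bigE)
  have "\<forall>\<^sub>F w in filtercomap length at_top. T' w < \<infinity>"
    using fin by eventually_elim (metis le ennreal_less_top infinity_ennreal_def order_le_less_trans)
  moreover have "\<forall>\<^sub>F w in filtercomap length at_top. norm (enn2real (T' w)) \<le>
      (C * c\<^sup>2) * norm (l ^ (2 * length w) * (s (length w))\<^sup>2)"
    using fin c(2)
  proof eventually_elim
    case (elim w)
    have "enn2real (T' w) \<le> C * l ^ (2 * length w) * (enn2real (T w))\<^sup>2"
      using le[OF elim(1)] assms by (intro enn2real_leI) auto
    also have "(enn2real (T w))\<^sup>2 \<le> (c * norm (s (length w)))\<^sup>2"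
      using elim(2) by (intro power_mono) auto
    finally have "enn2real (T' w) \<le> C * l ^ (2 * length w) * (c * norm (s (length w)))\<^sup>2"
      using assms by (simp add: mult_left_mono)
    then show ?case using assms by (simp add: power_mult_distrib abs_mult mult_ac)
  qed
  then have "(\<lambda>w. enn2real (T' w)) \<in> O[filtercomap length at_top](\<lambda>w. l ^ (2 * length w) * (s (length w))\<^sup>2)"
    by (rule landau_o.bigI[rotated]) (use c assms(1) in auto)
  ultimately show ?thesis by (simp add: time_bigo_def)
qed

section \<open>Error and running time of the constructed machines\<close>

context amplitude_machine
begin

abbreviation "amp_acc w \<equiv> amp m B (r Accepting) (tape w) q0"
abbreviation "amp_rej w \<equiv> amp m B (r Rejecting) (tape w) q0"

lemma halting_run_machine:
  assumes "(amp_acc w)\<^sup>2 + (amp_rej w)\<^sup>2 > 0"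
  shows "halting_run (qfa_start M) (qfa_step M) w"
  using assms m_pos
  by unfold_locales (auto simp: round_prob_start simp flip: add_divide_distrib)

text \<open>The scaling factor is common to both outcomes of a round and cancels in the
  ratio.\<close>

lemma machine_probs:
  assumes pos: "(amp_acc w)\<^sup>2 + (amp_rej w)\<^sup>2 > 0"
  shows "acc_prob (qfa_start M) (qfa_step M) w = (amp_acc w)\<^sup>2 / ((amp_acc w)\<^sup>2 + (amp_rej w)\<^sup>2)"
    and "rej_prob (qfa_start M) (qfa_step M) w = (amp_rej w)\<^sup>2 / ((amp_acc w)\<^sup>2 + (amp_rej w)\<^sup>2)"
proof -
  interpret H: halting_run "qfa_start M" "qfa_step M" w by (rule halting_run_machine[OF pos])
  show "acc_prob (qfa_start M) (qfa_step M) w = (amp_acc w)\<^sup>2 / ((amp_acc w)\<^sup>2 + (amp_rej w)\<^sup>2)"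
    and "rej_prob (qfa_start M) (qfa_step M) w = (amp_rej w)\<^sup>2 / ((amp_acc w)\<^sup>2 + (amp_rej w)\<^sup>2)"
    using m_pos by (simp_all add: H.acceptance_limits round_prob_start flip: add_divide_distrib)
qed

text \<open>The time is at most the tape length times the expected number of rounds. Here
  \<open>(4 * m) ^ 4\<close> comes from the two end-markers, and the base \<open>8 * m\<close>
  instead of \<open>4 * m\<close> leaves a factor \<open>4 ^ length w\<close> for the tape
  length.\<close>

lemma machine_time_le:
  assumes pos: "(amp_acc w)\<^sup>2 + (amp_rej w)\<^sup>2 > 0" and t: "1 / ((amp_acc w)\<^sup>2 + (amp_rej w)\<^sup>2) \<le> 8 * t\<^sup>2"
  shows "qfa_time M w \<le> ennreal (16 * (4 * real m) ^ 4 * (8 * real m) ^ (2 * length w) * t\<^sup>2)"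
proof -
  interpret H: halting_run "qfa_start M" "qfa_step M" w by (rule halting_run_machine[OF pos])
  let ?N = "length (tape w)" and ?k = "length w" and ?l = "4 * real m"
  have "qfa_time M w \<le> ennreal (?N / (((amp_acc w)\<^sup>2 + (amp_rej w)\<^sup>2) / ?l ^ (2 * ?N)))"
    using H.expected_time_le by (simp add: qfa_time_def round_prob_start flip: add_divide_distrib)
  also have "?N / (((amp_acc w)\<^sup>2 + (amp_rej w)\<^sup>2) / ?l ^ (2 * ?N)) =
      ?N * ?l ^ (2 * ?N) * (1 / ((amp_acc w)\<^sup>2 + (amp_rej w)\<^sup>2))" by simp
  also have "\<dots> \<le> ?N * ?l ^ (2 * ?N) * (8 * t\<^sup>2)" by (intro mult_left_mono t) auto
  also have "\<dots> \<le> (2 * 4 ^ ?k) * ?l ^ (2 * ?N) * (8 * t\<^sup>2)"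
  proof (intro mult_right_mono)
    have "?k + 2 \<le> 2 * 4 ^ ?k" by (induction w) auto
    then show "real ?N \<le> 2 * 4 ^ ?k" by (simp add: tape_def flip: of_nat_le_iff[where 'a = real])
  qed auto
  also have "\<dots> = 16 * ?l ^ 4 * (8 * real m) ^ (2 * ?k) * t\<^sup>2"
  proof -
    have "?l ^ (2 * ?N) = ?l ^ 4 * ?l ^ (2 * ?k)"
    proof -
      have "2 * ?N = 4 + 2 * ?k" by (simp add: tape_def)
      then show ?thesis by (simp only: power_add)
    qed
    moreover have "(8 * real m) ^ (2 * ?k) = 4 ^ ?k * ?l ^ (2 * ?k)"
    proof -
      have "8 * real m = 2 * ?l" by simp
      then show ?thesis by (simp only: power_mult_distrib) (simp add: power_mult)
    qed
    ultimately show ?thesis by (simp only: mult_ac)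
  qed
  finally show ?thesis by (simp add: ennreal_leI)
qed

end

text \<open>Identity matrices and constant output 1 give both answers amplitude 1 on every input.
  The size and the time bound match those of the simulation, so that the cases of small and large
  error can be merged.\<close>

lemma exists_fair_machine:
  fixes n :: nat
  shows "\<exists>M :: 'a qfa. is_qfa_restart M \<and> qfa_size M = 2 * n + 4 \<and>
    (\<forall>w. acc_prob (qfa_start M) (qfa_step M) w = 1 / 2 \<and> rej_prob (qfa_start M) (qfa_step M) w = 1 / 2 \<and>
      (\<forall>t\<ge>1. qfa_time M w \<le> ennreal (16 * (4 * real (n + 1)) ^ 4 * (8 * real (n + 1)) ^ (2 * length w) * t\<^sup>2)))"
proof -
  let ?m = "n + 1" and ?B = "\<lambda>(\<sigma> :: 'a tape_symbol) i j. of_bool (i = j) :: real" and ?r = "\<lambda>_ _. 1 :: real"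
  obtain M where "amplitude_machine ?m 0 ?B ?r M"
    using exists_amplitude_machine[of 0 ?m ?B ?r] by auto
  then interpret amplitude_machine ?m 0 ?B ?r M .
  have "amp ?m ?B (\<lambda>_. 1) (u @ [Right_End]) j = 1" if "j < ?m" for u j
    using that
  proof (induction u arbitrary: j)
    case (Cons \<sigma> u)
    have "(\<Sum>i<?m. amp ?m ?B (\<lambda>_. 1) (u @ [Right_End]) i * of_bool (i = j)) = (\<Sum>i<?m. if i = j then 1 else 0)"
      using Cons.IH by (intro sum.cong) auto
    also have "\<dots> = 1" using Cons.prems by simp
    finally show ?case by simp
  qed simp
  from this[of 0 "Left_End # map Letter w" for w] have one: "amp_acc w = 1" "amp_rej w = 1" for w
    by (simp_all add: tape_def)
  have half: "acc_prob (qfa_start M) (qfa_step M) w = 1 / 2" "rej_prob (qfa_start M) (qfa_step M) w = 1 / 2" for w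
    using machine_probs[of w, unfolded one] by simp_all
  have time: "qfa_time M w \<le> ennreal (16 * (4 * real ?m) ^ 4 * (8 * real ?m) ^ (2 * length w) * t\<^sup>2)"
    if "t \<ge> 1" for w t
    using one_le_power[OF that, of 2] by (intro machine_time_le; unfold one) simp_all
  show ?thesis
    using is_qfa_restart size half time by (intro exI[of _ M]) simp
qed

text \<open>One coordinate is added to the \<open>n\<close> states, the other accumulator reusing a
  round-ending state; hence \<open>m = n + 1\<close> and the size \<open>2 * m + 2\<close> is
  \<open>2 * n + 4\<close>.\<close>

lemma exists_simulation:
  fixes P :: "'a pfa"
  assumes P: "is_pfa_restart P" and \<epsilon>: "\<epsilon> < 1 / 2" and rec: "pfa_recognizes P L \<epsilon>"
  defines "n \<equiv> pfa_size P"
  shows "\<exists>M :: 'a qfa. is_qfa_restart M \<and> qfa_size M = 2 * n + 4 \<and> qfa_recognizes M L \<epsilon> \<and>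
    (\<forall>w. pfa_time P w < \<infinity> \<longrightarrow> qfa_time M w \<le>
      ennreal (16 * (4 * real (n + 1)) ^ 4 * (8 * real (n + 1)) ^ (2 * length w) * (enn2real (pfa_time P w))\<^sup>2))"
proof -
  let ?q0 = "pfa_init P" and ?\<delta> = "pfa_step P"
  define pa where "pa w = round_prob ?\<delta> Accepting (tape w) ?q0" for w
  define pr where "pr w = round_prob ?\<delta> Rejecting (tape w) ?q0" for w
  have q0: "?q0 < n" "pfa_kind P ?q0 = Nonhalting" using P by (auto simp: is_pfa_restart_def n_def)
  have nn: "pa w \<ge> 0" "pr w \<ge> 0" for w by (simp_all add: pa_def pr_def round_prob_nonneg)
  have R: "restart_run ?q0 ?\<delta> w" for w by (rule pfa_restart_run[OF P])
  have rec': "w \<in> L \<Longrightarrow> acc_prob ?q0 ?\<delta> w \<ge> 1 - \<epsilon>" "w \<notin> L \<Longrightarrow> rej_prob ?q0 ?\<delta> w \<ge> 1 - \<epsilon>" for w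
    using rec by (auto simp: pfa_recognizes_def recognizes_def)
  \<comment> \<open>Without any chance of halting in a round both answers would have probability 0,
    contradicting an error below 1/2.\<close>
  have pos: "pa w + pr w > 0" for w
    using restart_run.no_halt_imp_zero[OF R, of w] rec'[of w] \<epsilon> by (fastforce simp: pa_def pr_def)
  have H: "halting_run ?q0 ?\<delta> w" for w
    using pos[of w] R by (simp add: halting_run_def halting_run_axioms_def pa_def pr_def)
  note lims = halting_run.acceptance_limits[OF H, folded pa_def pr_def]
  have "\<exists>h<n. pfa_kind P h \<noteq> Nonhalting"
  proof (rule ccontr)
    assume "\<not> ?thesis"
    then have "pa [] = 0" "pr [] = 0"
      using no_halting_state_imp_zero[OF P] q0(1) by (auto simp: pa_def pr_def n_def)
    then show False using pos[of "[]"] by simp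
  qed
  then obtain h where h: "h < pfa_size P" "pfa_kind P h \<noteq> Nonhalting" by (auto simp: n_def)
  have qh: "?q0 < pfa_size P" "?q0 \<noteq> h" using q0 h by (auto simp: n_def)
  obtain M where "amplitude_machine (n + 1) ?q0 (round_matrix P h) (round_output P h) M"
    using exists_amplitude_machine[of ?q0 "n + 1" "round_matrix P h" "round_output P h"] q0
      abs_round_matrix_le[OF P] abs_round_output_le[OF P] by (auto simp: n_def)
  then interpret amplitude_machine "n + 1" ?q0 "round_matrix P h" "round_output P h" M .
  have "Right_End \<notin> set (Left_End # map Letter w)" for w :: "'a list" by auto
  note amp_eq = amp_eq_round_prob[OF P _ h this, THEN conjunct1, rule_format]
  have tape: "tape w = (Left_End # map Letter w) @ [Right_End]" for w :: "'a list" by (simp add: tape_def)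
  have amp: "amp_acc w = pa w" "amp_rej w = pr w" for w
    unfolding pa_def pr_def n_def tape Suc_eq_plus1[symmetric] by (rule amp_eq; simp add: qh)+
  \<comment> \<open>Comparison of arithmetic and quadratic mean: it bounds the squared halting
    probability of a classical round by the weights of a quantum round.\<close>
  have sq: "(pa w + pr w)\<^sup>2 \<le> 2 * ((pa w)\<^sup>2 + (pr w)\<^sup>2)" for w
    using zero_le_power2[of "pa w - pr w"] by (simp add: power2_eq_square algebra_simps)
  have sq_pos: "(pa w)\<^sup>2 + (pr w)\<^sup>2 > 0" for w
    using less_le_trans[OF zero_less_power[OF pos[of w]] sq[of w]] by (simp only: zero_less_mult_iff) simp
  note probs = machine_probs[unfolded amp, OF sq_pos]
  have "qfa_recognizes M L \<epsilon>"
    unfolding qfa_recognizes_def recognizes_def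
  proof (intro allI conjI impI)
    fix w
    show "acc_prob (qfa_start M) (qfa_step M) w \<ge> 1 - \<epsilon>" if "w \<in> L"
      unfolding probs using rec'(1)[OF that] lims(1)[of w] nn pos[of w] \<epsilon> by (intro square_ratio_ge) auto
    show "rej_prob (qfa_start M) (qfa_step M) w \<ge> 1 - \<epsilon>" if "w \<notin> L"
      unfolding probs add.commute[of "(pa w)\<^sup>2"] using rec'(2)[OF that] lims(2)[of w] nn pos[of w] \<epsilon>
      by (intro square_ratio_ge) (auto simp: add.commute)
  qed
  moreover have "qfa_time M w \<le> ennreal (16 * (4 * real (n + 1)) ^ 4 * (8 * real (n + 1)) ^ (2 * length w) *
      (enn2real (pfa_time P w))\<^sup>2)" if fin: "pfa_time P w < \<infinity>" for w
  proof (rule machine_time_le; unfold amp)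
    define t where "t = enn2real (pfa_time P w)"
    have T: "pfa_time P w = ennreal t" using fin by (simp add: t_def)
    have "t \<ge> 0" by (simp add: t_def)
    \<comment> \<open>Turns \<open>1 / (pa w + pr w) \<le> t + 1\<close> into the bound
      \<open>2 * t\<close>; squaring this and doubling gives the constant 8.\<close>
    have t1: "t \<ge> 1" using expected_time_ge_1[of ?q0 ?\<delta> w] T \<open>t \<ge> 0\<close> by (simp add: pfa_time_def)
    have "ennreal (1 / (pa w + pr w) - 1) \<le> ennreal t"
      using halting_run.expected_time_ge[OF H, of w] T by (simp add: pfa_time_def pa_def pr_def)
    then have "1 / (pa w + pr w) - 1 \<le> t" using \<open>t \<ge> 0\<close> by (simp add: ennreal_le_iff)
    with t1 have "1 / (pa w + pr w) \<le> 2 * t" by linarith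
    then have "(1 / (pa w + pr w))\<^sup>2 \<le> (2 * t)\<^sup>2" using pos[of w] by (intro power_mono) auto
    moreover have "1 / ((pa w)\<^sup>2 + (pr w)\<^sup>2) \<le> 2 * (1 / (pa w + pr w))\<^sup>2"
    proof -
      have "2 / (2 * ((pa w)\<^sup>2 + (pr w)\<^sup>2)) \<le> 2 / (pa w + pr w)\<^sup>2"
        using sq_pos[of w] zero_less_power[OF pos[of w], of 2]
        by (intro divide_left_mono sq mult_pos_pos) auto
      moreover have "2 / (2 * x) = 1 / x" for x :: real by (cases "x = 0") auto
      ultimately show ?thesis by (simp only: power_divide) simp
    qed
    ultimately show "1 / ((pa w)\<^sup>2 + (pr w)\<^sup>2) \<le> 8 * (enn2real (pfa_time P w))\<^sup>2"
      by (simp add: t_def power_mult_distrib)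
  qed (rule sq_pos)
  ultimately show ?thesis using is_qfa_restart size by (intro exI[of _ M]) simp
qed

theorem theorem8:
  fixes n :: nat
  shows "\<exists>l::real. l > 1 \<and>
    (\<forall>(L :: 'a::finite list set) (\<epsilon> :: real) (P :: 'a pfa).
       is_pfa_restart P \<and> pfa_size P = n \<and> pfa_recognizes P L \<epsilon> \<longrightarrow>
       (\<exists>M :: 'a qfa.
          is_qfa_restart M \<and> qfa_size M = 2 * n + 4 \<and> qfa_recognizes M L \<epsilon> \<and>
          (\<forall>s :: nat \<Rightarrow> real. time_bigo (pfa_time P) s \<longrightarrow>
             time_bigo (qfa_time M) (\<lambda>m. l ^ (2 * m) * (s m)\<^sup>2))))"
proof (intro exI[of _ "8 * real (n + 1)"] conjI allI impI)
  \<comment> \<open>The base is that of \<open>machine_time_le\<close> at \<open>m = n + 1\<close>;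
    it depends on \<open>n\<close> alone and serves both the simulation and the fair
    machine.\<close>
  show "1 < 8 * real (n + 1)" by simp
  fix L :: "'a list set" and \<epsilon> and P :: "'a pfa"
  assume "is_pfa_restart P \<and> pfa_size P = n \<and> pfa_recognizes P L \<epsilon>"
  then have P: "is_pfa_restart P" and n: "pfa_size P = n" and rec: "pfa_recognizes P L \<epsilon>" by auto
  have "\<exists>M :: 'a qfa. is_qfa_restart M \<and> qfa_size M = 2 * n + 4 \<and> qfa_recognizes M L \<epsilon> \<and>
    (\<forall>w. pfa_time P w < \<infinity> \<longrightarrow> qfa_time M w \<le>
      ennreal (16 * (4 * real (n + 1)) ^ 4 * (8 * real (n + 1)) ^ (2 * length w) * (enn2real (pfa_time P w))\<^sup>2))"
  proof (cases "\<epsilon> < 1 / 2")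
    case True
    then show ?thesis using exists_simulation[OF P True rec] n by simp
  next
    case False
    obtain M :: "'a qfa" where M: "is_qfa_restart M" "qfa_size M = 2 * n + 4"
      "\<And>w. acc_prob (qfa_start M) (qfa_step M) w = 1 / 2" "\<And>w. rej_prob (qfa_start M) (qfa_step M) w = 1 / 2"
      "\<And>w t. t \<ge> 1 \<Longrightarrow> qfa_time M w \<le>
        ennreal (16 * (4 * real (n + 1)) ^ 4 * (8 * real (n + 1)) ^ (2 * length w) * t\<^sup>2)"
      using exists_fair_machine[of n] by blast
    \<comment> \<open>Allows the time of \<open>P\<close> to be inserted for \<open>t\<close> in the
      bound of the fair machine.\<close>
    have "enn2real (pfa_time P w) \<ge> 1" if "pfa_time P w < \<infinity>" for w
      using expected_time_ge_1[of "pfa_init P" "pfa_step P" w] that enn2real_mono[of 1 "pfa_time P w"]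
      by (simp add: pfa_time_def)
    moreover have "qfa_recognizes M L \<epsilon>" 
      unfolding qfa_recognizes_def recognizes_def M(3) M(4) using False by auto
    ultimately show ?thesis using M by blast
  qed
  then obtain M :: "'a qfa" where M: "is_qfa_restart M" "qfa_size M = 2 * n + 4" "qfa_recognizes M L \<epsilon>"
    "\<And>w. pfa_time P w < \<infinity> \<Longrightarrow> qfa_time M w \<le> ennreal (16 * (4 * real (n + 1)) ^ 4 *
      (8 * real (n + 1)) ^ (2 * length w) * (enn2real (pfa_time P w))\<^sup>2)" by blast
  have "time_bigo (qfa_time M) (\<lambda>m. (8 * real (n + 1)) ^ (2 * m) * (s m)\<^sup>2)"
    if "time_bigo (pfa_time P) s" for s
    using M(4) that by (intro time_bigo_transfer[of "16 * (4 * real (n + 1)) ^ 4" _ "pfa_time P"]) auto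
  then show "\<exists>M :: 'a qfa. is_qfa_restart M \<and> qfa_size M = 2 * n + 4 \<and> qfa_recognizes M L \<epsilon> \<and>
    (\<forall>s. time_bigo (pfa_time P) s \<longrightarrow>
      time_bigo (qfa_time M) (\<lambda>m. (8 * real (n + 1)) ^ (2 * m) * (s m)\<^sup>2))"
    using M by blast
qed

end
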